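(* Let $\mathcal{C} \subseteq \mathbb{R}^N$ be a compact convex set with nonempty interior and $0 \in \mathrm{int}(\mathcal{C})$, and let $\mathcal{P}^{\mathcal{C}} : \mathbb{R}^N \to \mathcal{C}$ denote the projection onto $\mathcal{C}$. Then there exists a sequence of locally Lipschitz maps $\mathcal{F}^{\mathcal{C}}_m : \mathbb{R}^N \to \mathbb{R}^N$, $m \in \mathbb{N}$, which satisfies: (i) Each $\mathcal{F}^{\mathcal{C}}_m$ is piecewise equal to a composition of finitely many successive affine reflections. In particular, for a.e. $u \in \mathbb{R}^N$ there is an $R \in O(N,\mathbb{R})$ such that $D\mathcal{F}^{\mathcal{C}}_m(u) = R$. (ii) Each $\mathcal{F}^{\mathcal{C}}_m$ equals the identity on $\mathcal{C}$ and maps the $m$-dilate of $\mathcal{C}$ into the $(1+\frac{1}{m})$-dilate of $\mathcal{C}$: $$\mathcal{F}^{\mathcal{C}}_m(E) = E \ \text{ for all } E \subseteq \mathcal{C}, \qquad \mathcal{F}^{\mathcal{C}}_m(m\,\mathcal{C}) \subseteq \Big(1+\frac{1}{m}\Big)\mathcal{C}.$$ (iii) The sequence $\mathcal{F}^{\mathcal{C}}_m$ is a locally uniform approximation of the projection onto $\mathcal{C}$ (that is, $\mathcal{F}^{\mathcal{C}}_m \to \mathcal{P}^{\mathcal{C}}$ locally uniformly on $\mathbb{R}^N$ as $m\to\infty$); moreover, $\mathcal{F}^{\mathcal{C}}_m \overset{*}{\rightharpoonup} \mathcal{P}^{\mathcal{C}}$ weakly$^*$ in $[W^{1,\infty}_{\mathrm{loc}}(\mathbb{R}^N)]^N$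 as $m \to \infty$.
   Context: $O(N,\mathbb{R})$ is the orthogonal group of $\mathbb{R}^N$. For a unit vector $\xi \in \mathbb{S}^{N-1}$ and $u_0 \in \mathbb{R}^N$, the affine reflection with respect to the hyperplane $(\mathrm{span}[\xi])^\perp + u_0$ is the map $u \mapsto u - 2\big((u-u_0)\cdot \xi\big)\xi$. The empty composition (the identity) is allowed among compositions of finitely many affine reflections. "Piecewise equal" means that $\mathbb{R}^N$ is covered by a locally finite family of closed sets on each of which the map coincides with one such composition. The projection $\mathcal{P}^{\mathcal{C}}$ is the nearest-point projection onto $\mathcal{C}$. For $s>0$, the $s$-dilate is $s\,\mathcal{C} = \{su : u \in \mathcal{C}\}$. Weak$^*$ convergence in $[W^{1,\infty}_{\mathrm{loc}}(\mathbb{R}^N)]^N$ means that the maps and their gradients converge weakly$^*$ in $L^\infty$ on every bounded subset of $\mathbb{R}^N$. *)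

theory Defs
  imports "HOL-Analysis.Analysis"
begin

definition locally_lipschitz :: "('a::metric_space \<Rightarrow> 'b::metric_space) \<Rightarrow> bool" where
  "locally_lipschitz f \<longleftrightarrow> (\<forall>x. \<exists>e>0. \<exists>L. lipschitz_on L (ball x e) f)"


section \<open>Piecewise reflections\<close>

definition affine_reflection :: "'a::real_inner \<Rightarrow> 'a \<Rightarrow> 'a \<Rightarrow> 'a" where
  "affine_reflection \<xi> u0 u = u - (2 * ((u - u0) \<bullet> \<xi>)) *\<^sub>R \<xi>"

inductive_set reflection_compositions :: "('a::real_inner \<Rightarrow> 'a) set" where
  empty: "id \<in> reflection_compositions"
| step: "norm \<xi> = 1 \<Longrightarrow> g \<in> reflection_compositions
      \<Longrightarrow> affine_reflection \<xi> u0 \<circ> g \<in> reflection_compositions"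

definition piecewise_reflections :: "('a::euclidean_space \<Rightarrow> 'a) \<Rightarrow> bool" where
  "piecewise_reflections f \<longleftrightarrow>
     (\<exists>\<A>. locally_finite_in euclidean \<A> \<and> \<Union>\<A> = UNIV \<and>
        (\<forall>A\<in>\<A>. closed A \<and> (\<exists>g\<in>reflection_compositions. \<forall>u\<in>A. f u = g u)))"


section \<open>Weak Jacobians\<close>

definition partial_derivative :: "'n::finite \<Rightarrow> (real^'n \<Rightarrow> real) \<Rightarrow> real^'n \<Rightarrow> real" where
  "partial_derivative j f x = frechet_derivative f (at x) (axis j 1)"

text \<open>Class \<open>C\<^sup>k\<close> on the whole space.  The differentiability conjunct matters because
  the library's Fr\'echet derivative is an arbitrary value where no derivative exists.\<close>

primrec C_k :: "nat \<Rightarrow> (real^'n::finite \<Rightarrow> real) \<Rightarrow> bool" where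
  "C_k 0 f \<longleftrightarrow> continuous_on UNIV f"
| "C_k (Suc k) f \<longleftrightarrow> f differentiable_on UNIV \<and> (\<forall>j. C_k k (partial_derivative j f))"

definition test_function :: "(real^'n::finite \<Rightarrow> real) \<Rightarrow> bool" where
  "test_function \<phi> \<longleftrightarrow> (\<forall>k. C_k k \<phi>) \<and> compact (closure {x. \<phi> x \<noteq> 0})"

definition locally_integrable :: "('a::euclidean_space \<Rightarrow> 'b::euclidean_space) \<Rightarrow> bool" where
  "locally_integrable f \<longleftrightarrow> (\<forall>K. compact K \<longrightarrow> f absolutely_integrable_on K)"

text \<open>The distributional gradient: the entry \<open>G x $ i $ j\<close> is the weak
  \<open>j\<close>-th partial derivative of the \<open>i\<close>-th component of \<open>f\<close>.\<close>

definition is_weak_jacobian ::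
    "(real^'n::finite \<Rightarrow> real^'m::finite) \<Rightarrow> (real^'n \<Rightarrow> real^'n^'m) \<Rightarrow> bool" where
  "is_weak_jacobian f G \<longleftrightarrow> locally_integrable f \<and> locally_integrable G \<and>
     (\<forall>\<phi> i j. test_function \<phi> \<longrightarrow>
        (LINT x|lebesgue. f x $ i * partial_derivative j \<phi> x)
          = - (LINT x|lebesgue. G x $ i $ j * \<phi> x))"


section \<open>Weak-star convergence\<close>

definition L_infinity :: "'a::euclidean_space set \<Rightarrow> ('a \<Rightarrow> 'b::euclidean_space) \<Rightarrow> bool" where
  "L_infinity \<Omega> f \<longleftrightarrow> f \<in> borel_measurable (lebesgue_on \<Omega>) \<and>
     (\<exists>B. AE x in lebesgue_on \<Omega>. norm (f x) \<le> B)"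

text \<open>Pairing vector-valued functions with all scalar \<open>h \<in> L\<^sup>1\<close> amounts to weak-star
  convergence of every component.\<close>

definition weak_star_L_infinity ::
    "'a::euclidean_space set \<Rightarrow> (nat \<Rightarrow> 'a \<Rightarrow> 'b::euclidean_space) \<Rightarrow> ('a \<Rightarrow> 'b) \<Rightarrow> bool" where
  "weak_star_L_infinity \<Omega> f g \<longleftrightarrow> (\<forall>m. L_infinity \<Omega> (f m)) \<and> L_infinity \<Omega> g \<and>
     (\<forall>h::'a \<Rightarrow> real. integrable (lebesgue_on \<Omega>) h \<longrightarrow>
        (\<lambda>m. LINT x|lebesgue_on \<Omega>. h x *\<^sub>R f m x)
          \<longlonglongrightarrow> (LINT x|lebesgue_on \<Omega>. h x *\<^sub>R g x))"

text \<open>Membership of all maps in \<open>W\<^sup>1\<^sup>,\<^sup>\<infinity>\<close>, locally, is part of this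
  notion.  Weak Jacobians are unique up to null sets, so their choice is immaterial.\<close>

definition weak_star_W1_infinity_loc ::
    "(nat \<Rightarrow> real^'n::finite \<Rightarrow> real^'m::finite) \<Rightarrow> (real^'n \<Rightarrow> real^'m) \<Rightarrow> bool" where
  "weak_star_W1_infinity_loc f g \<longleftrightarrow>
     (\<exists>Df Dg. (\<forall>m. is_weak_jacobian (f m) (Df m)) \<and> is_weak_jacobian g Dg \<and>
        (\<forall>\<Omega>\<in>sets lebesgue. bounded \<Omega> \<longrightarrow>
           weak_star_L_infinity \<Omega> f g \<and> weak_star_L_infinity \<Omega> Df Dg))"

end

theory Submission
  imports Defs "HOL-Real_Asymp.Real_Asymp"
begin

text \<open>
The approximating maps are finite compositions of folds.  The fold along a hyperplane reflects the
half-space on one side onto the other side and fixes the latter; it is nonexpansive and piecewise a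
reflection or the identity, and both properties pass to compositions.  A fold fixes \<open>C\<close> pointwise as
soon as \<open>C\<close> lies on the fixed side.

\<^bold>\<open>Convergence to the projection.\<close>
Let \<open>d\<close> be the distance to \<open>C\<close> and \<open>P\<close> the projection.  Since \<open>P x\<close> is the only point of \<open>C\<close> at
distance \<open>d x\<close> from \<open>x\<close>, it suffices to construct \<open>F\<close> such that \<open>F x\<close> is almost in \<open>C\<close> and
\<open>dist x (F x)\<close> is hardly larger than \<open>d x\<close> (\<open>near_projection\<close>).  An arbitrary succession of folds
along hyperplanes near \<open>C\<close> may violate the second requirement, because the path from \<open>x\<close> to \<open>F x\<close> may
slide along the boundary of \<open>C\<close>.  The remedy is to strip off thin layers \<open>t \<le> d \<le> t + e\<close> from the
outside inwards.  A fold along a hyperplane that is parallel to a supporting hyperplane of \<open>C\<close> and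
lies at distance \<open>t + e / 2\<close> from it only affects points of such a layer at which its normal almost
equals the gradient of \<open>d\<close>.  It therefore displaces a point by at most \<open>1 + e / t\<close> times the
decrease of \<open>d\<close> (\<open>cap_fold_displacement\<close>), and this estimate telescopes over all folds and all layers.
By compactness finitely many folds remove the outer sixteenth of a layer (\<open>layer_fold\<close>), and
\<open>t = \<tau>\<close>, \<open>e = \<tau>\<^sup>2\<close> give the required map (\<open>almost_projecting_fold\<close>).

\<^bold>\<open>Weak-star convergence.\<close>
The entries of the Jacobians of these maps are bounded by \<open>1\<close>.  Integrated against a function that is
smooth in the direction of differentiation they converge, since the derivative can be moved to that
function; by approximation in \<open>L\<^sup>1\<close> they converge when integrated over boxes, over Borel sets, and
against all integrable functions.  The limit functional is represented by a bounded density
(\<open>weak_star_limit_exists\<close>), and integration by parts identifies this density as a weak derivative of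
\<open>P\<close> (\<open>weak_derivative_limit\<close>).\<close>

section \<open>Compositions of hyperplane folds\<close>

definition fold_across :: "'a::real_inner \<Rightarrow> real \<Rightarrow> 'a \<Rightarrow> 'a" where
  "fold_across n b x = x - (2 * max 0 (x \<bullet> n - b)) *\<^sub>R n"

inductive_set fold_compositions :: "('a::real_inner \<Rightarrow> 'a) set" where
  id: "id \<in> fold_compositions"
| fold: "norm n = 1 \<Longrightarrow> F \<in> fold_compositions \<Longrightarrow> fold_across n b \<circ> F \<in> fold_compositions"

lemma fold_across_below: "x \<bullet> n \<le> b \<Longrightarrow> fold_across n b x = x"
  by (simp add: fold_across_def)

lemma fold_across_above:
  assumes "norm n = 1" "b \<le> x \<bullet> n"
  shows "fold_across n b x = affine_reflection n (b *\<^sub>R n) x"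
  using assms by (simp add: fold_across_def affine_reflection_def inner_diff_left norm_eq_1)

lemma fold_compositions_comp:
  assumes "F \<in> fold_compositions" "G \<in> fold_compositions"
  shows "F \<circ> G \<in> fold_compositions"
  using assms by (induction rule: fold_compositions.induct) (auto simp: comp_assoc intro: fold_compositions.fold)

text \<open>The map \<open>t \<mapsto> max 0 (t - b)\<close> is monotone and nonexpansive, so the difference \<open>p\<close> of its two values
lies between \<open>0\<close> and the difference \<open>s\<close> of the arguments; subtracting \<open>2 p n\<close> from \<open>x - y\<close> changes
the squared norm by \<open>- 4 p (s - p)\<close>.\<close>

lemma fold_across_nonexpansive:
  assumes "norm n = 1"
  shows "dist (fold_across n b x) (fold_across n b y) \<le> dist x y"
proof -
  define p where "p = max 0 (x \<bullet> n - b) - max 0 (y \<bullet> n - b)"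
  define s where "s = (x - y) \<bullet> n"
  have "0 \<le> p * (s - p)"
    unfolding p_def s_def by (auto simp: max_def inner_diff_left mult_nonneg_nonneg mult_nonpos_nonpos)
  moreover have "(norm ((x - y) - (2 * p) *\<^sub>R n))\<^sup>2 = (norm (x - y))\<^sup>2 - 4 * (p * (s - p))"
    using assms unfolding s_def power2_norm_eq_inner
    by (simp add: norm_eq_1 inner_diff_left inner_diff_right inner_commute algebra_simps)
  ultimately have "(norm ((x - y) - (2 * p) *\<^sub>R n))\<^sup>2 \<le> (norm (x - y))\<^sup>2"
    by linarith
  then have "norm ((x - y) - (2 * p) *\<^sub>R n) \<le> norm (x - y)"
    by (rule power2_le_imp_le) simp
  moreover have "fold_across n b x - fold_across n b y = (x - y) - (2 * p) *\<^sub>R n"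
    by (simp add: fold_across_def p_def algebra_simps)
  ultimately show ?thesis by (simp add: dist_norm)
qed

lemma fold_compositions_nonexpansive:
  assumes "F \<in> fold_compositions"
  shows "dist (F x) (F y) \<le> dist x y"
  using assms
  by (induction rule: fold_compositions.induct)
     (auto intro: order_trans[OF fold_across_nonexpansive])

lemma fold_compositions_lipschitz:
  "F \<in> fold_compositions \<Longrightarrow> 1-lipschitz_on X F"
  by (simp add: lipschitz_on_def fold_compositions_nonexpansive)

lemma fold_compositions_continuous:
  "F \<in> fold_compositions \<Longrightarrow> continuous_on X F"
  using fold_compositions_lipschitz lipschitz_on_continuous_on by blast

lemma reflection_compositions_isometry:
  assumes "g \<in> reflection_compositions"
  shows "\<exists>R. orthogonal_transformation R \<and> (\<forall>u. g u = g 0 + R u)"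
  using assms
proof (induction rule: reflection_compositions.induct)
  case empty
  then show ?case by (intro exI[of _ id]) (auto simp: orthogonal_transformation_def)
next
  case (step \<xi> g u0)
  then obtain R where R: "orthogonal_transformation R" "\<And>u. g u = g 0 + R u" by blast
  define S where "S v = v - (2 * (v \<bullet> \<xi>)) *\<^sub>R \<xi>" for v
  have "linear S"
    by (rule linearI) (auto simp: S_def inner_add_left algebra_simps)
  moreover have "S v \<bullet> S w = v \<bullet> w" for v w
    using step(1) by (simp add: S_def norm_eq_1 inner_diff_left inner_diff_right inner_commute)
  ultimately have "orthogonal_transformation S"
    by (simp add: orthogonal_transformation_def)
  then have "orthogonal_transformation (S \<circ> R)"
    using R(1) orthogonal_transformation_compose by blast
  moreover have "(affine_reflection \<xi> u0 \<circ> g) u = (affine_reflection \<xi> u0 \<circ> g) 0 + (S \<circ> R) u" for u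
    unfolding comp_def R(2)[of u] by (simp add: affine_reflection_def S_def inner_add_left inner_diff_left algebra_simps)
  ultimately show ?case by blast
qed

lemma reflection_compositions_continuous:
  fixes g :: "'a::euclidean_space \<Rightarrow> 'a"
  assumes "g \<in> reflection_compositions"
  shows "continuous_on X g"
proof -
  obtain R where R: "orthogonal_transformation R" "\<And>u. g u = g 0 + R u"
    using reflection_compositions_isometry[OF assms] by blast
  then have "continuous_on X (\<lambda>u. g 0 + R u)"
    by (intro continuous_intros linear_continuous_on_compose[OF continuous_on_id])
       (auto simp: orthogonal_transformation_linear)
  then show ?thesis using R(2) by (metis continuous_on_cong)
qed

text \<open>The pullback of a hyperplane under the isometry \<open>g\<close> is again a hyperplane, whose normal is the
preimage of \<open>n\<close> under the linear part of \<open>g\<close>.\<close>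

lemma negligible_reflection_composition_hyperplane:
  fixes g :: "'a::euclidean_space \<Rightarrow> 'a"
  assumes "g \<in> reflection_compositions" "norm n = 1"
  shows "negligible {u. g u \<bullet> n = b}"
proof -
  obtain R where R: "orthogonal_transformation R" "\<And>u. g u = g 0 + R u"
    using reflection_compositions_isometry[OF assms(1)] by blast
  have lin: "linear R" using R(1) by (rule orthogonal_transformation_linear)
  have "surj R" using R(1) by (rule orthogonal_transformation_surj)
  then obtain z where z: "R z = n" by (metis surj_def)
  have "R u \<bullet> n = z \<bullet> u" for u
    using R(1) z by (metis orthogonal_transformation_def inner_commute)
  then have "{u. g u \<bullet> n = b} = {u. z \<bullet> u = b - g 0 \<bullet> n}"
    by (subst R(2)) (auto simp: inner_add_left)
  moreover have "z \<noteq> 0" using z assms(2) lin linear_0 by fastforce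
  ultimately show ?thesis by (simp add: negligible_hyperplane)
qed

text \<open>Folding composes each branch \<open>g\<close> either with the identity or with one reflection, so finitely many
branches suffice.  A point leaves the region where a single branch is valid only if some branch
carries it onto the fold hyperplane, and the branches being isometries, these points fill only
finitely many hyperplanes.  The exceptional null set is recorded together with the branches because
closed sets on which \<open>F\<close> agrees with a branch may have boundaries of positive measure.\<close>

lemma fold_compositions_branches:
  fixes F :: "'a::euclidean_space \<Rightarrow> 'a"
  assumes "F \<in> fold_compositions"
  shows "\<exists>G. finite G \<and> G \<subseteq> reflection_compositions \<and> (\<forall>u. \<exists>g\<in>G. F u = g u) \<and>
    negligible {u. \<not> (\<exists>g\<in>G. \<forall>\<^sub>F v in nhds u. F v = g v)}"
  using assms
proof (induction rule: fold_compositions.induct)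
  case id
  show ?case by (intro exI[of _ "{id}"]) (auto intro: reflection_compositions.empty)
next
  case (fold n F b)
  from fold(3) obtain G where G: "finite G" "G \<subseteq> reflection_compositions"
    "\<And>u. \<exists>g\<in>G. F u = g u" "negligible {u. \<not> (\<exists>g\<in>G. \<forall>\<^sub>F v in nhds u. F v = g v)}"
    by blast
  define r where "r = affine_reflection n (b *\<^sub>R n)"
  define G' where "G' = G \<union> (\<circ>) r ` G"
  have two: "fold_across n b x = x \<or> fold_across n b x = r x" for x
    using fold_across_below[of x n b] fold_across_above[OF fold(1), of b x] by (cases "x \<bullet> n \<le> b") (auto simp: r_def)
  have "\<exists>g\<in>G'. (fold_across n b \<circ> F) u = g u" for u
  proof -
    obtain g where "g \<in> G" "F u = g u" using G(3)[of u] by blast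
    then show ?thesis
      using two[of "F u"] by (auto simp: G'_def intro: bexI[of _ g] bexI[of _ "r \<circ> g"])
  qed
  moreover have "negligible {u. \<not> (\<exists>g\<in>G'. \<forall>\<^sub>F v in nhds u. (fold_across n b \<circ> F) v = g v)}"
  proof (rule negligible_subset)
    show "negligible ({u. \<not> (\<exists>g\<in>G. \<forall>\<^sub>F v in nhds u. F v = g v)} \<union> (\<Union>g\<in>G. {u. g u \<bullet> n = b}))"
      using G negligible_reflection_composition_hyperplane[OF _ fold(1)] by (auto intro!: negligible_Union)
    show "{u. \<not> (\<exists>g\<in>G'. \<forall>\<^sub>F v in nhds u. (fold_across n b \<circ> F) v = g v)}
        \<subseteq> {u. \<not> (\<exists>g\<in>G. \<forall>\<^sub>F v in nhds u. F v = g v)} \<union> (\<Union>g\<in>G. {u. g u \<bullet> n = b})"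
    proof (rule subsetI, rule ccontr)
      fix u assume "u \<in> {u. \<not> (\<exists>g\<in>G'. \<forall>\<^sub>F v in nhds u. (fold_across n b \<circ> F) v = g v)}"
        and u: "u \<notin> {u. \<not> (\<exists>g\<in>G. \<forall>\<^sub>F v in nhds u. F v = g v)} \<union> (\<Union>g\<in>G. {u. g u \<bullet> n = b})"
      then have none: "\<not> (\<forall>\<^sub>F v in nhds u. (fold_across n b \<circ> F) v = g v)" if "g \<in> G'" for g
        using that by blast
      obtain g where g: "g \<in> G" "\<forall>\<^sub>F v in nhds u. F v = g v" "g u \<bullet> n \<noteq> b"
        using u by blast
      have "isCont g u"
        using reflection_compositions_continuous[of g UNIV] G(2) g(1) continuous_on_eq_continuous_at by blast
      then have "(g \<longlongrightarrow> g u) (nhds u)"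
        using tendsto_at_iff_tendsto_nhds[of g u] by (simp add: isCont_def)
      then have lim: "((\<lambda>v. g v \<bullet> n) \<longlongrightarrow> g u \<bullet> n) (nhds u)"
        by (intro tendsto_intros)
      consider "g u \<bullet> n < b" | "g u \<bullet> n > b" using g(3) by linarith
      then show False
      proof cases
        case 1
        then have "\<forall>\<^sub>F v in nhds u. g v \<bullet> n < b" using order_tendstoD(2)[OF lim] by blast
        then have "\<forall>\<^sub>F v in nhds u. (fold_across n b \<circ> F) v = g v"
          using g(2) by eventually_elim (simp add: fold_across_below)
        then show False using none[of g] g(1) by (simp add: G'_def)
      next
        case 2
        then have "\<forall>\<^sub>F v in nhds u. g v \<bullet> n > b" using order_tendstoD(1)[OF lim] by blast
        then have "\<forall>\<^sub>F v in nhds u. (fold_across n b \<circ> F) v = (r \<circ> g) v"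
          using g(2) by eventually_elim (simp add: fold_across_above[OF fold(1)] r_def)
        then show False using none[of "r \<circ> g"] g(1) by (simp add: G'_def)
      qed
    qed
  qed
  moreover have "finite G'" "G' \<subseteq> reflection_compositions"
    using G fold(1) by (auto simp: G'_def r_def intro: reflection_compositions.step)
  ultimately show ?case by blast
qed

lemma fold_compositions_piecewise_reflections:
  fixes F :: "'a::euclidean_space \<Rightarrow> 'a"
  assumes "F \<in> fold_compositions"
  shows "piecewise_reflections F"
proof -
  obtain G where G: "finite G" "G \<subseteq> reflection_compositions" "\<And>u. \<exists>g\<in>G. F u = g u"
    using fold_compositions_branches[OF assms] by blast
  define \<A> where "\<A> = (\<lambda>g. {u. F u = g u}) ` G"
  have "locally_finite_in euclidean \<A>"
    using G(1) by (intro finite_imp_locally_finite_in) (auto simp: \<A>_def)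
  moreover have "\<Union>\<A> = UNIV" using G(3) by (auto simp: \<A>_def)
  moreover have "closed {u. F u = g u}" if "g \<in> G" for g
    using that G(2)
    by (intro closed_Collect_eq fold_compositions_continuous[OF assms] reflection_compositions_continuous) auto
  ultimately show ?thesis
    unfolding piecewise_reflections_def using G(2) by (intro exI[of _ \<A>]) (auto simp: \<A>_def)
qed

lemma fold_compositions_derivative_ae:
  fixes F :: "real^'n::finite \<Rightarrow> real^'n"
  assumes "F \<in> fold_compositions"
  shows "AE u in lebesgue. \<exists>R::real^'n^'n. orthogonal_matrix R \<and>
          (F has_derivative (\<lambda>v. R *v v)) (at u)"
proof -
  obtain G where G: "G \<subseteq> reflection_compositions"
    "negligible {u. \<not> (\<exists>g\<in>G. \<forall>\<^sub>F v in nhds u. F v = g v)}" (is "negligible ?N")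
    using fold_compositions_branches[OF assms] by blast
  have *: "\<exists>R::real^'n^'n. orthogonal_matrix R \<and> (F has_derivative (\<lambda>v. R *v v)) (at u)"
    if "u \<notin> ?N" for u
  proof -
    obtain g where g: "g \<in> G" "\<forall>\<^sub>F v in nhds u. F v = g v" using \<open>u \<notin> ?N\<close> by blast
    then obtain R where R: "orthogonal_transformation R" "\<And>u. g u = g 0 + R u"
      using reflection_compositions_isometry G(1) by blast
    have lin: "linear R" using R(1) by (rule orthogonal_transformation_linear)
    then have "((\<lambda>v. g 0 + R v) has_derivative R) (at u)"
      by (auto intro!: derivative_eq_intros linear_imp_has_derivative)
    moreover have "g = (\<lambda>v. g 0 + R v)" using R(2) by (intro ext)
    ultimately have "(g has_derivative R) (at u)" by simp
    moreover have "\<forall>\<^sub>F v in at u. g v = F v"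
      using g(2) by (simp add: eventually_at_filter eventually_mono)
    moreover have "g u = F u" using eventually_nhds_x_imp_x[OF g(2)] by simp
    ultimately have "(F has_derivative R) (at u)"
      by (rule has_derivative_transform_eventually) simp
    moreover have "R = (\<lambda>v. matrix R *v v)" using lin by (simp add: matrix_works)
    moreover have "orthogonal_matrix (matrix R)"
      using R(1) orthogonal_transformation_matrix by blast
    ultimately show ?thesis by metis
  qed
  show ?thesis
    using G(2) * unfolding negligible_iff_null_sets by (intro AE_I'[of ?N]) auto
qed

section \<open>Folding a neighbourhood of a convex body towards it\<close>

locale convex_body =
  fixes C :: "'a::euclidean_space set"
  assumes compact: "compact C" and convex: "convex C" and nonempty: "C \<noteq> {}"
begin

abbreviation P where "P \<equiv> closest_point C"

definition d where "d x = dist x (P x)"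

definition normal where "normal y = (y - P y) /\<^sub>R d y"

lemma closed: "closed C"
  using compact by (rule compact_imp_closed)

lemma P_in: "P x \<in> C"
  using closed nonempty by (rule closest_point_in_set)

lemma P_obtuse: "z \<in> C \<Longrightarrow> (x - P x) \<bullet> (z - P x) \<le> 0"
  using convex closed by (rule closest_point_dot)

lemma d_nonneg [simp]: "0 \<le> d x"
  by (simp add: d_def)

lemma d_le: "z \<in> C \<Longrightarrow> d x \<le> dist x z"
  unfolding d_def using closed by (rule closest_point_le)

lemma continuous_on_d: "continuous_on X d"
  unfolding d_def using convex closed nonempty
  by (intro continuous_intros continuous_on_closest_point)

lemma normal_inner: "(y - P y) \<bullet> z = d y * (normal y \<bullet> z)"
  by (cases "d y = 0") (auto simp: normal_def d_def)

lemma norm_normal: "0 < d y \<Longrightarrow> norm (normal y) = 1"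
  by (simp add: normal_def d_def dist_norm)

lemma inner_normal_self: "y \<bullet> normal y = P y \<bullet> normal y + d y"
proof (cases "d y = 0")
  case False
  have "d y * (normal y \<bullet> (y - P y)) = d y * d y"
    unfolding normal_inner[symmetric] by (simp add: d_def dist_norm power2_norm_eq_inner[symmetric] power2_eq_square)
  then show ?thesis using False by (simp add: inner_diff_right inner_commute)
qed (auto simp: normal_def)

lemma inner_normal_le:
  assumes "z \<in> C"
  shows "z \<bullet> normal y \<le> P y \<bullet> normal y"
proof (cases "d y = 0")
  case False
  then have "0 < d y" using d_nonneg[of y] by linarith
  moreover have "d y * (normal y \<bullet> (z - P y)) \<le> 0"
    using P_obtuse[OF assms, of y] normal_inner by simp
  ultimately have "normal y \<bullet> (z - P y) \<le> 0" by (simp add: mult_le_0_iff)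
  then show ?thesis by (simp add: inner_diff_right inner_commute)
qed (auto simp: normal_def)

text \<open>The fold hyperplane is parallel to the supporting hyperplane of \<open>C\<close> at \<open>P y\<close>, at distance
\<open>t + e / 2\<close> from it.  The choice of the middle of the layer \<open>t \<le> d \<le> t + e\<close> has the effect that points
of that layer which are reflected land at height at least \<open>t\<close> above the supporting hyperplane.\<close>

definition cap_fold where
  "cap_fold t e y = fold_across (normal y) (P y \<bullet> normal y + t + e / 2)"

lemma cap_fold_id:
  assumes "x \<in> C" "0 \<le> t" "0 \<le> e"
  shows "cap_fold t e y x = x"
  unfolding cap_fold_def using inner_normal_le[OF assms(1), of y] assms by (intro fold_across_below) simp

lemma cap_fold_inner_le:
  assumes "0 < d y"
  shows "cap_fold t e y x \<bullet> normal y \<le> P y \<bullet> normal y + t + e / 2"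
  using norm_normal[OF assms]
  by (simp add: cap_fold_def fold_across_def inner_diff_left norm_eq_1 max_def)

text \<open>A fold that moves a point almost against the gradient of the distance \<open>d\<close> shortens the distance by
almost the length of the move.  If \<open>x'\<close> is the image of \<open>x\<close>, the gradient of \<open>d\<close> at \<open>x'\<close> is
\<open>m = normal x'\<close>, and \<open>x'\<close> still lies at height at least \<open>t\<close> above the supporting hyperplane with
normal \<open>n\<close>, whereas its distance to \<open>C\<close> is at most \<open>t + e\<close>; hence \<open>m \<bullet> n \<ge> t / (t + e)\<close>.  Convexity of
\<open>d\<close> turns this into \<open>d x - d x' \<ge> (m \<bullet> n) * dist x x'\<close>.\<close>

lemma cap_fold_displacement:
  assumes y: "0 < d y" and t: "0 < t" and e: "0 \<le> e" and x: "d x \<le> t + e"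
  shows "dist x (cap_fold t e y x) \<le> (1 + e / t) * (d x - d (cap_fold t e y x))"
proof -
  define n where "n = normal y"
  define h where "h = P y \<bullet> n"
  define x' where "x' = cap_fold t e y x"
  have n1: "norm n = 1" "n \<bullet> n = 1" using norm_normal[OF y] by (auto simp: n_def norm_eq_1)
  show ?thesis
  proof (cases "x \<bullet> n \<le> h + t + e / 2")
    case True
    then have "cap_fold t e y x = x" by (simp add: cap_fold_def fold_across_below n_def h_def)
    then show ?thesis by simp
  next
    case False
    define l where "l = 2 * (x \<bullet> n - (h + t + e / 2))"
    have l: "0 \<le> l" using False by (simp add: l_def)
    have x': "x' = x - l *\<^sub>R n"
      using False by (simp add: x'_def cap_fold_def fold_across_def n_def h_def l_def)
    have "(x - P x) \<bullet> n \<le> d x"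
      using Cauchy_Schwarz_ineq2[of "x - P x" n] n1 by (simp add: d_def dist_norm)
    moreover have "P x \<bullet> n \<le> h" using inner_normal_le[OF P_in] by (simp add: h_def n_def)
    ultimately have "x \<bullet> n \<le> h + t + e" using x by (simp add: inner_diff_left)
    then have "h + t \<le> x' \<bullet> n" by (simp add: x' inner_diff_left n1 l_def)
    moreover have "P x' \<bullet> n \<le> h" using inner_normal_le[OF P_in] by (simp add: h_def n_def)
    ultimately have t_le: "t \<le> (x' - P x') \<bullet> n" by (simp add: inner_diff_left)
    also have "\<dots> \<le> d x'"
      using Cauchy_Schwarz_ineq2[of "x' - P x'" n] n1 by (simp add: d_def dist_norm)
    finally have d': "t \<le> d x'" .
    define m where "m = normal x'"
    have m1: "norm m = 1" using norm_normal[of x'] d' t by (simp add: m_def)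
    have "(x - P x) \<bullet> m \<le> d x"
      using Cauchy_Schwarz_ineq2[of "x - P x" m] m1 by (simp add: d_def dist_norm)
    moreover have "P x \<bullet> m \<le> P x' \<bullet> m" using inner_normal_le[OF P_in] by (simp add: m_def)
    moreover have "x \<bullet> m = x' \<bullet> m + l * (m \<bullet> n)"
      by (simp add: x' inner_diff_left inner_commute[of n])
    moreover have "x' \<bullet> m = P x' \<bullet> m + d x'" unfolding m_def by (rule inner_normal_self)
    \<comment> \<open>Convexity of the distance: its linearization at the image point is a lower bound at the original point.\<close>
    ultimately have drop: "l * (m \<bullet> n) \<le> d x - d x'" by (simp add: inner_diff_left)
    have "t \<le> d x' * (m \<bullet> n)" using t_le normal_inner[of x' n] by (simp add: m_def)
    then have mn: "t / d x' \<le> m \<bullet> n" using d' t by (simp add: field_simps)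
    moreover have "0 < t / d x'" using d' t by simp
    ultimately have "0 \<le> m \<bullet> n" by linarith
    then have "d x' \<le> d x" using drop l mult_nonneg_nonneg[of l "m \<bullet> n"] by linarith
    then have "l * t \<le> l * ((m \<bullet> n) * (t + e))"
    proof -
      have "t \<le> (m \<bullet> n) * d x'" using \<open>t \<le> d x' * (m \<bullet> n)\<close> by (simp add: mult.commute)
      also have "\<dots> \<le> (m \<bullet> n) * (t + e)"
        using \<open>d x' \<le> d x\<close> x \<open>0 \<le> m \<bullet> n\<close> by (intro mult_left_mono) auto
      finally show ?thesis using l by (intro mult_left_mono)
    qed
    also have "\<dots> \<le> (d x - d x') * (t + e)"
      using mult_right_mono[OF drop, of "t + e"] t e by (simp add: mult.assoc)
    finally have "l \<le> (1 + e / t) * (d x - d x')"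
      using t by (simp add: field_simps)
    moreover have "dist x x' = l" using l n1 by (simp add: x' dist_norm)
    ultimately show ?thesis by (simp add: x'_def)
  qed
qed

text \<open>On the neighbourhood \<open>d \<le> r\<close> the displacement of \<open>F\<close> is charged to the decrease of \<open>d\<close>.  In this form
the estimate telescopes under composition, with the same factor \<open>k\<close>, whatever the number of folds.\<close>

definition good_fold where
  "good_fold k r s F \<longleftrightarrow> F \<in> fold_compositions \<and> (\<forall>x\<in>C. F x = x) \<and>
     (\<forall>x. d x \<le> r \<longrightarrow> d (F x) \<le> s \<and> dist x (F x) \<le> k * (d x - d (F x)))"

lemma good_fold_comp:
  assumes "good_fold k r s F" "good_fold k s q G"
  shows "good_fold k r q (G \<circ> F)"
  unfolding good_fold_def
proof (intro conjI ballI allI impI)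
  show "G \<circ> F \<in> fold_compositions"
    using assms by (auto simp: good_fold_def intro: fold_compositions_comp)
  show "(G \<circ> F) x = x" if "x \<in> C" for x
    using assms that by (auto simp: good_fold_def)
  fix x assume x: "d x \<le> r"
  then have F: "d (F x) \<le> s" "dist x (F x) \<le> k * (d x - d (F x))"
    using assms(1) by (auto simp: good_fold_def)
  then have G: "d (G (F x)) \<le> q" "dist (F x) (G (F x)) \<le> k * (d (F x) - d (G (F x)))"
    using assms(2) by (auto simp: good_fold_def)
  show "d ((G \<circ> F) x) \<le> q" using G by simp
  have "dist x (G (F x)) \<le> dist x (F x) + dist (F x) (G (F x))" by (rule dist_triangle)
  also have "\<dots> \<le> k * (d x - d (G (F x)))" using F G by (simp add: algebra_simps)
  finally show "dist x ((G \<circ> F) x) \<le> k * (d x - d ((G \<circ> F) x))" by simp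
qed

text \<open>The factor may be increased because \<open>d (F x) \<le> d x\<close>: the map is nonexpansive and fixes \<open>P x\<close>.\<close>

lemma good_fold_mono:
  assumes "good_fold k r s F" "k \<le> k'"
  shows "good_fold k' r s F"
proof -
  have "k * (d x - d (F x)) \<le> k' * (d x - d (F x))" if "d x \<le> r" for x
  proof -
    have "\<exists>z\<in>C. dist x z = d x" using P_in d_def by metis
    then obtain z where z: "z \<in> C" "dist x z = d x" by blast
    have "d (F x) \<le> dist (F x) (F z)" using z assms(1) by (auto simp: good_fold_def d_le)
    also have "\<dots> \<le> d x"
      using fold_compositions_nonexpansive[of F x z] assms(1) z by (simp add: good_fold_def)
    finally show ?thesis using assms(2) by (intro mult_right_mono) auto
  qed
  then show ?thesis using assms(1) unfolding good_fold_def by (meson order_trans)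
qed

text \<open>After the fold belonging to \<open>y\<close> a point is below the fold hyperplane of \<open>y\<close>.  Later folds may push
it up again, but by no more than their displacement, which is paid for by the decrease of \<open>d\<close>.\<close>

lemma cap_folds:
  assumes "finite Y" "\<And>y. y \<in> Y \<Longrightarrow> 0 < d y" and t: "0 < t" and e: "0 \<le> e"
  shows "\<exists>F. good_fold (1 + e / t) (t + e) (t + e) F \<and>
    (\<forall>x y. d x \<le> t + e \<longrightarrow> y \<in> Y \<longrightarrow>
      F x \<bullet> normal y \<le> P y \<bullet> normal y + t + e / 2 + (1 + e / t) * (d x - d (F x)))"
  using assms(1,2)
proof (induction Y rule: finite_induct)
  case empty
  show ?case
    by (intro exI[of _ id]) (auto simp: good_fold_def fold_compositions.id[unfolded id_def] id_def)
next
  case (insert w Y)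
  define k where "k = 1 + e / t"
  have k: "0 \<le> k" using t e by (simp add: k_def)
  obtain F where F: "good_fold k (t + e) (t + e) F"
    "\<And>x y. d x \<le> t + e \<Longrightarrow> y \<in> Y \<Longrightarrow>
      F x \<bullet> normal y \<le> P y \<bullet> normal y + t + e / 2 + k * (d x - d (F x))"
    using insert unfolding k_def by auto
  define f where "f = cap_fold t e w"
  have w: "0 < d w" using insert.prems by simp
  have step: "dist x (f x) \<le> k * (d x - d (f x))" if "d x \<le> t + e" for x
    using cap_fold_displacement[OF w t e that] by (simp add: f_def k_def)
  have f_le: "d (f x) \<le> d x" if "d x \<le> t + e" for x
  proof -
    have "0 \<le> k * (d x - d (f x))" using step[OF that] zero_le_dist[of x "f x"] by linarith
    moreover have "0 < k" using t e by (simp add: k_def add_pos_nonneg)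
    ultimately show ?thesis by (simp add: zero_le_mult_iff)
  qed
  have "f \<in> fold_compositions"
    using fold_compositions.fold[OF norm_normal[OF w] fold_compositions.id] by (simp add: f_def cap_fold_def)
  then have f: "good_fold k (t + e) (t + e) f"
    using step f_le t e by (auto simp: good_fold_def f_def cap_fold_id intro: order_trans)
  have "f (F x) \<bullet> normal y \<le> P y \<bullet> normal y + t + e / 2 + k * (d x - d (f (F x)))"
    if x: "d x \<le> t + e" and y: "y \<in> insert w Y" for x y
  proof -
    have Fx: "d (F x) \<le> t + e" "dist x (F x) \<le> k * (d x - d (F x))"
      using F(1) x by (auto simp: good_fold_def)
    have pos: "0 \<le> k * (d x - d (f (F x)))"
      using Fx step[OF Fx(1)] zero_le_dist[of x "F x"] zero_le_dist[of "F x" "f (F x)"]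
      unfolding right_diff_distrib by linarith
    show ?thesis
    proof (cases "y = w")
      case True
      have "f (F x) \<bullet> normal y \<le> P y \<bullet> normal y + t + e / 2"
        unfolding True f_def by (rule cap_fold_inner_le[OF w])
      then show ?thesis using pos by linarith
    next
      case False
      then have "y \<in> Y" using y by simp
      then have "norm (normal y) = 1" using insert.prems by (simp add: norm_normal)
      then have "(f (F x) - F x) \<bullet> normal y \<le> dist (F x) (f (F x))"
        using Cauchy_Schwarz_ineq2[of "f (F x) - F x" "normal y"] by (simp add: dist_norm norm_minus_commute)
      then show ?thesis
        using F(2)[OF x \<open>y \<in> Y\<close>] step[OF Fx(1)] by (simp add: inner_diff_left algebra_simps)
    qed
  qed
  then have "\<forall>x y. d x \<le> t + e \<longrightarrow> y \<in> insert w Y \<longrightarrow> (f \<circ> F) x \<bullet> normal y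
      \<le> P y \<bullet> normal y + t + e / 2 + k * (d x - d ((f \<circ> F) x))"
    by simp
  then show ?case
    using good_fold_comp[OF F(1) f] unfolding k_def by blast
qed

text \<open>The shell \<open>K\<close> of outermost points is compact, so the folds of a finite \<open>e / 4\<close>-net \<open>Y\<close> are
available.  Suppose an image point were still in \<open>K\<close>.  It is within \<open>e / 4\<close> of some \<open>y\<close> in \<open>Y\<close> and
hence at height at least \<open>(15/16 - 1/4) e = 11/16 e\<close> above level \<open>t\<close> in the direction \<open>normal y\<close>.  But
its distance to \<open>C\<close> decreased by at most \<open>e / 16\<close>, so the preceding lemma bounds this height by
\<open>e / 2 + 2 * e / 16 = 10/16 e\<close>.\<close>

lemma layer_fold:
  assumes t: "0 < t" and e: "0 < e" "e \<le> t"
  shows "\<exists>F. good_fold (1 + e / t) (t + e) (t + 15 / 16 * e) F"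
proof -
  define K where "K = {x. t + 15 / 16 * e \<le> d x \<and> d x \<le> t + e}"
  have "closed K"
    unfolding K_def by (intro closed_Collect_conj closed_Collect_le continuous_on_d continuous_intros)
  moreover have "bounded K"
  proof -
    obtain B where B: "\<And>z. z \<in> C \<Longrightarrow> norm z \<le> B"
      using compact_imp_bounded[OF compact] unfolding bounded_iff by blast
    have "norm x \<le> B + t + e" if "x \<in> K" for x
      using that B[OF P_in[of x]] norm_triangle_ineq[of "P x" "x - P x"] by (simp add: K_def d_def dist_norm)
    then show ?thesis unfolding bounded_iff by blast
  qed
  ultimately have "compact K" by (simp add: compact_eq_bounded_closed)
  then obtain Y where Y: "finite Y" "Y \<subseteq> K" "K \<subseteq> (\<Union>y\<in>Y. ball y (e / 4))"
    using compactE_image[of K K "\<lambda>y. ball y (e / 4)"] e by force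
  have pos: "0 < d y" if "y \<in> Y" for y
    using that Y(2) t e by (auto simp: K_def)
  define k where "k = 1 + e / t"
  obtain F where F: "good_fold k (t + e) (t + e) F"
    "\<And>x y. d x \<le> t + e \<Longrightarrow> y \<in> Y \<Longrightarrow>
      F x \<bullet> normal y \<le> P y \<bullet> normal y + t + e / 2 + k * (d x - d (F x))"
    using cap_folds[OF Y(1) pos t, of e] e unfolding k_def by auto
  have "d (F x) \<le> t + 15 / 16 * e" if x: "d x \<le> t + e" for x
  proof (rule ccontr)
    assume far: "\<not> d (F x) \<le> t + 15 / 16 * e"
    have "d (F x) \<le> t + e" using F(1) x by (simp add: good_fold_def)
    then have "F x \<in> K" using far by (simp add: K_def)
    then obtain y where y: "y \<in> Y" "dist y (F x) < e / 4" using Y(3) by auto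
    have "(y - F x) \<bullet> normal y \<le> dist y (F x)"
      using Cauchy_Schwarz_ineq2[of "y - F x" "normal y"] norm_normal[OF pos[OF y(1)]] by (simp add: dist_norm)
    then have "y \<bullet> normal y - e / 4 \<le> F x \<bullet> normal y" using y(2) by (simp add: inner_diff_left)
    moreover have "t + 15 / 16 * e \<le> d y" using y(1) Y(2) by (auto simp: K_def)
    ultimately have "P y \<bullet> normal y + t + 11 / 16 * e \<le> F x \<bullet> normal y"
      using inner_normal_self[of y] by simp
    moreover have "k * (d x - d (F x)) \<le> 2 * (e / 16)"
    proof (rule mult_mono)
      show "k \<le> 2" using t e by (simp add: k_def)
      show "d x - d (F x) \<le> e / 16" using x far by simp
      have "0 \<le> k * (d x - d (F x))"
        using F(1) x zero_le_dist[of x "F x"] unfolding good_fold_def by (meson order_trans)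
      moreover have "0 < k" using t e by (simp add: k_def add_pos_pos)
      ultimately show "0 \<le> d x - d (F x)" by (simp add: zero_le_mult_iff)
    qed simp
    ultimately show False using F(2)[OF x y(1)] e by simp
  qed
  then have "good_fold k (t + e) (t + 15 / 16 * e) F"
    using F(1) by (auto simp: good_fold_def)
  then show ?thesis unfolding k_def by blast
qed

text \<open>Thin layers are stripped off from the outside inwards.  Every layer starts at a level \<open>t' \<ge> t\<close>, so
all of them share the factor \<open>1 + e / t\<close>.\<close>

lemma thick_fold:
  assumes t: "0 < t" and e: "0 < e" "e \<le> t"
  shows "\<exists>F. good_fold (1 + e / t) (t + e + real N * (e / 16)) (t + e) F"
proof (induction N)
  case 0
  show ?case
    by (intro exI[of _ id]) (auto simp: good_fold_def fold_compositions.id[unfolded id_def] id_def)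
next
  case (Suc N)
  then obtain F where F: "good_fold (1 + e / t) (t + e + real N * (e / 16)) (t + e) F" by blast
  define t' where "t' = t + real (Suc N) * (e / 16)"
  have t': "t \<le> t'" using e by (simp add: t'_def)
  obtain G where "good_fold (1 + e / t') (t' + e) (t' + 15 / 16 * e) G"
    using layer_fold[of t' e] t t' e by auto
  moreover have "1 + e / t' \<le> 1 + e / t" using t t' e by (simp add: frac_le)
  ultimately have "good_fold (1 + e / t) (t' + e) (t' + 15 / 16 * e) G"
    by (rule good_fold_mono)
  moreover have "t' + 15 / 16 * e = t + e + real N * (e / 16)"
    "t' + e = t + e + real (Suc N) * (e / 16)" by (simp_all add: t'_def field_simps)
  ultimately show ?case using good_fold_comp[OF _ F] by metis
qed

text \<open>With \<open>t = \<tau>\<close> and layers of thickness \<open>e = \<tau>\<^sup>2\<close> both the remaining distance \<open>t + e\<close> and the relative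
excess \<open>e / t\<close> of the displacement are controlled by \<open>\<tau>\<close>.\<close>

lemma almost_projecting_fold:
  assumes \<tau>: "0 < \<tau>" "\<tau> \<le> 1"
  shows "\<exists>F\<in>fold_compositions. (\<forall>x\<in>C. F x = x) \<and>
    (\<forall>x. d x \<le> r \<longrightarrow> d (F x) \<le> 2 * \<tau> \<and> dist x (F x) \<le> (1 + \<tau>) * d x)"
proof -
  define e where "e = \<tau> * \<tau>"
  have e: "0 < e" "e \<le> \<tau>" "e / \<tau> = \<tau>"
    using \<tau> mult_left_mono[of \<tau> 1 \<tau>] by (auto simp: e_def)
  obtain N where N: "r < real N * (e / 16)"
    using reals_Archimedean3[of "e / 16"] e by auto
  obtain F where F: "good_fold (1 + \<tau>) (\<tau> + e + real N * (e / 16)) (\<tau> + e) F"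
    using thick_fold[OF \<tau>(1) e(1,2)] e(3) by metis
  have "d (F x) \<le> 2 * \<tau> \<and> dist x (F x) \<le> (1 + \<tau>) * d x" if "d x \<le> r" for x
  proof -
    have "d x \<le> \<tau> + e + real N * (e / 16)" using that N e \<tau> by linarith
    then have "d (F x) \<le> \<tau> + e" "dist x (F x) \<le> (1 + \<tau>) * (d x - d (F x))"
      using F by (auto simp: good_fold_def)
    moreover have "(1 + \<tau>) * (d x - d (F x)) \<le> (1 + \<tau>) * d x"
      using \<tau> by (intro mult_left_mono) auto
    ultimately show ?thesis using e by linarith
  qed
  then show ?thesis using F by (auto simp: good_fold_def)
qed

text \<open>Among the points of \<open>C\<close> only \<open>P x\<close> has distance \<open>d x\<close> from \<open>x\<close>.  Quantitatively, for \<open>q\<close> in \<open>C\<close>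
the obtuse angle at \<open>P x\<close> gives \<open>(dist (P x) q)\<^sup>2 \<le> (dist x q)\<^sup>2 - (d x)\<^sup>2\<close>; here \<open>q\<close> is the projection
of \<open>z\<close>.\<close>

lemma near_projection:
  assumes \<tau>: "0 \<le> \<tau>" "\<tau> \<le> 1" and z: "d z \<le> 2 * \<tau>" "dist x z \<le> (1 + \<tau>) * d x" and r: "d x \<le> r"
  shows "dist z (P x) \<le> 2 * \<tau> + sqrt (\<tau> * ((r + 2) * (3 * r + 2)))"
proof -
  define q where "q = P z"
  have q: "dist z q \<le> 2 * \<tau>" using z by (simp add: q_def d_def)
  have r0: "0 \<le> r" using r d_nonneg[of x] by linarith
  have "dist x q \<le> (1 + \<tau>) * d x + 2 * \<tau>"
    using dist_triangle[of x q z] z(2) q by linarith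
  then have "(dist x q)\<^sup>2 \<le> ((1 + \<tau>) * d x + 2 * \<tau>)\<^sup>2" by (intro power_mono) auto
  also have "\<dots> = (d x)\<^sup>2 + \<tau> * ((d x + 2) * (2 * d x + \<tau> * d x + 2 * \<tau>))"
    by (simp add: power2_eq_square algebra_simps)
  finally have far: "(dist x q)\<^sup>2 - (d x)\<^sup>2 \<le> \<tau> * ((d x + 2) * (2 * d x + \<tau> * d x + 2 * \<tau>))" by simp
  have "\<tau> * d x \<le> 1 * d x" using \<tau> by (intro mult_right_mono) auto
  then have "2 * d x + \<tau> * d x + 2 * \<tau> \<le> 3 * r + 2" using r \<tau> by linarith
  then have "\<tau> * ((d x + 2) * (2 * d x + \<tau> * d x + 2 * \<tau>)) \<le> \<tau> * ((r + 2) * (3 * r + 2))"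
    using r r0 \<tau> by (intro mult_left_mono mult_mono) auto
  moreover have "(dist (P x) q)\<^sup>2 \<le> (dist x q)\<^sup>2 - (d x)\<^sup>2"
  proof -
    have "(dist x q)\<^sup>2 = (d x)\<^sup>2 + (dist (P x) q)\<^sup>2 - 2 * ((x - P x) \<bullet> (q - P x))"
      by (simp add: dist_norm d_def power2_norm_eq_inner inner_diff_left inner_diff_right inner_commute algebra_simps)
    then show ?thesis using P_obtuse[of q x] P_in[of z] by (simp add: q_def)
  qed
  ultimately have "dist (P x) q \<le> sqrt (\<tau> * ((r + 2) * (3 * r + 2)))"
    using far by (intro real_le_rsqrt) linarith
  then show ?thesis using dist_triangle[of z "P x" q] q by (simp add: dist_commute)
qed

end

section \<open>Weak-star limits of bounded sequences\<close>

lemma L1_dominated_convergence: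
  fixes s :: "nat \<Rightarrow> 'a \<Rightarrow> real"
  assumes "\<And>i. s i \<in> borel_measurable M" "f \<in> borel_measurable M" "integrable M g"
    and "AE x in M. (\<lambda>i. s i x) \<longlonglongrightarrow> f x" "\<And>i. AE x in M. \<bar>s i x\<bar> \<le> g x"
  shows "(\<lambda>i. \<integral>x. \<bar>s i x - f x\<bar> \<partial>M) \<longlonglongrightarrow> 0"
proof -
  have "(\<lambda>i. \<integral>x. \<bar>s i x - f x\<bar> \<partial>M) \<longlonglongrightarrow> (\<integral>x. 0 \<partial>M)"
  proof (rule integral_dominated_convergence)
    show "integrable M (\<lambda>x. 2 * g x)" using assms by simp
    show "AE x in M. (\<lambda>i. \<bar>s i x - f x\<bar>) \<longlonglongrightarrow> 0"
      using assms(4) by eventually_elim (auto intro: tendsto_rabs_zero LIM_zero)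
    have "AE x in M. \<forall>i. \<bar>s i x\<bar> \<le> g x" using assms(5) by (simp add: AE_all_countable)
    then show "AE x in M. norm \<bar>s i x - f x\<bar> \<le> 2 * g x" for i
      using assms(4)
    proof eventually_elim
      case (elim x)
      have "\<bar>f x\<bar> \<le> g x"
        by (rule LIMSEQ_le_const2[OF tendsto_rabs[OF elim(2)]]) (use elim(1) in auto)
      then show ?case using elim(1)[rule_format, of i] by simp
    qed
  qed (use assms in auto)
  then show ?thesis by simp
qed

text \<open>Induction over integrable functions in which the limit case asks for closure under convergence in
\<open>L\<^sup>1\<close>, the mode of convergence respected by pairings with bounded functions.\<close>

lemma integrable_L1_induct [consumes 1, case_names indicator scale add lim]:
  fixes h :: "'a \<Rightarrow> real"
  assumes "integrable M h"
    and ind: "\<And>A. A \<in> sets M \<Longrightarrow> emeasure M A < \<infinity> \<Longrightarrow> P (indicator A)"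
    and scale: "\<And>f c. integrable M f \<Longrightarrow> P f \<Longrightarrow> P (\<lambda>x. c * f x)"
    and add: "\<And>f g. integrable M f \<Longrightarrow> P f \<Longrightarrow> integrable M g \<Longrightarrow> P g \<Longrightarrow> P (\<lambda>x. f x + g x)"
    and lim: "\<And>f s. (\<And>i::nat. integrable M (s i)) \<Longrightarrow> (\<And>i. P (s i)) \<Longrightarrow> integrable M f \<Longrightarrow>
       (\<lambda>i. \<integral>x. \<bar>s i x - f x\<bar> \<partial>M) \<longlonglongrightarrow> 0 \<Longrightarrow> P f"
  shows "P h"
  using assms(1)
proof (induction rule: integrable_induct)
  case (base A c)
  then show ?case using scale[OF _ ind, of A c] by (simp add: mult.commute)
next
  case (add f g)
  show ?case using add by (intro assms(4))
next
  case (lim f s)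
  have "(\<lambda>i. \<integral>x. \<bar>s i x - f x\<bar> \<partial>M) \<longlonglongrightarrow> 0"
    by (rule L1_dominated_convergence[where g = "\<lambda>x. 2 * \<bar>f x\<bar>"]) (use lim in auto)
  then show ?case using lim by (intro assms(5)[of s f])
qed

locale bounded_sequence =
  fixes M :: "'a measure" and D :: "nat \<Rightarrow> 'a \<Rightarrow> real" and B :: real
  assumes measurable_D [measurable]: "\<And>m. D m \<in> borel_measurable M"
    and abs_D_le: "\<And>m x. \<bar>D m x\<bar> \<le> B" and B_nonneg: "0 \<le> B"
begin

lemma integrable_pairing:
  assumes "integrable M h" "g \<in> borel_measurable M" "\<And>x. \<bar>g x\<bar> \<le> B"
  shows "integrable M (\<lambda>x. h x * g x)"
proof (rule Bochner_Integration.integrable_bound[where f = "\<lambda>x. B * h x"])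
  show "AE x in M. norm (h x * g x) \<le> norm (B * h x)"
    using assms(3) by (auto simp: abs_mult mult.commute intro!: mult_right_mono order_trans[OF assms(3)])
qed (use assms in auto)

lemma abs_pairing_le:
  assumes "integrable M h" "g \<in> borel_measurable M" "\<And>x. \<bar>g x\<bar> \<le> B"
  shows "\<bar>\<integral>x. h x * g x \<partial>M\<bar> \<le> B * (\<integral>x. \<bar>h x\<bar> \<partial>M)"
proof -
  have "\<bar>\<integral>x. h x * g x \<partial>M\<bar> \<le> (\<integral>x. \<bar>h x * g x\<bar> \<partial>M)" by (rule integral_abs_bound)
  also have "\<dots> \<le> (\<integral>x. B * \<bar>h x\<bar> \<partial>M)"
    using integrable_abs[OF integrable_pairing[OF assms]] assms
    by (intro integral_mono) (auto simp: abs_mult mult.commute[of B] intro: mult_left_mono)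
  finally show ?thesis by simp
qed

lemmas integrable_D = integrable_pairing[OF _ measurable_D abs_D_le]
lemmas abs_pairing_D = abs_pairing_le[OF _ measurable_D abs_D_le]

definition pairing_converges where
  "pairing_converges h \<longleftrightarrow> convergent (\<lambda>m. \<integral>x. h x * D m x \<partial>M)"

lemma pairing_converges_add:
  assumes "integrable M f" "pairing_converges f" "integrable M g" "pairing_converges g"
  shows "pairing_converges (\<lambda>x. f x + g x)"
  using convergent_add[OF assms(2,4)[unfolded pairing_converges_def]] assms(1,3)
  by (simp add: pairing_converges_def distrib_right integrable_D)

lemma pairing_converges_scale:
  assumes "pairing_converges f"
  shows "pairing_converges (\<lambda>x. c * f x)"
  using convergent_mult[OF convergent_const assms[unfolded pairing_converges_def], of c]
  by (simp add: pairing_converges_def mult.assoc)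

text \<open>The pairings with \<open>s i\<close> and with \<open>f\<close> differ by at most \<open>B\<close> times the \<open>L\<^sup>1\<close> distance, uniformly in \<open>m\<close>;
so the pairings with \<open>f\<close> form a Cauchy sequence.\<close>

lemma pairing_converges_limit:
  assumes s: "\<And>i::nat. integrable M (s i)" "\<And>i. pairing_converges (s i)" and f: "integrable M f"
    and lim: "(\<lambda>i. \<integral>x. \<bar>s i x - f x\<bar> \<partial>M) \<longlonglongrightarrow> 0"
  shows "pairing_converges f"
  unfolding pairing_converges_def
proof (rule Cauchy_convergent, rule metric_CauchyI)
  fix e :: real assume e: "0 < e"
  define I where "I h m = (\<integral>x. h x * D m x \<partial>M)" for h m
  have "(\<lambda>i. B * (\<integral>x. \<bar>s i x - f x\<bar> \<partial>M)) \<longlonglongrightarrow> 0"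
    using tendsto_mult_left[OF lim, of B] by simp
  then have "\<forall>\<^sub>F i in sequentially. B * (\<integral>x. \<bar>s i x - f x\<bar> \<partial>M) < e / 3"
    using e by (intro order_tendstoD(2)) auto
  then obtain i where i: "B * (\<integral>x. \<bar>s i x - f x\<bar> \<partial>M) < e / 3"
    by (auto simp: eventually_sequentially)
  have close: "\<bar>I (s i) m - I f m\<bar> < e / 3" for m
  proof -
    have "I (s i) m - I f m = (\<integral>x. (s i x - f x) * D m x \<partial>M)"
      using s(1) f by (simp add: I_def left_diff_distrib integrable_D)
    then show ?thesis using abs_pairing_D[of "\<lambda>x. s i x - f x" m] s(1) f i by simp
  qed
  have "Cauchy (I (s i))"
    using s(2)[of i] by (auto simp: pairing_converges_def I_def[abs_def] intro: convergent_Cauchy)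
  then obtain N where N: "\<And>m n. m \<ge> N \<Longrightarrow> n \<ge> N \<Longrightarrow> dist (I (s i) m) (I (s i) n) < e / 3"
    using metric_CauchyD[of "I (s i)" "e / 3"] e by auto
  have "dist (I f m) (I f n) < e" if "m \<ge> N" "n \<ge> N" for m n
    using close[of m] close[of n] N[OF that] unfolding dist_real_def by linarith
  then show "\<exists>N. \<forall>m\<ge>N. \<forall>n\<ge>N. dist (\<integral>x. f x * D m x \<partial>M) (\<integral>x. f x * D n x \<partial>M) < e"
    unfolding I_def by blast
qed

text \<open>The limit functional \<open>T\<close> satisfies \<open>\<bar>T h\<bar> \<le> B * \<integral>\<bar>h\<bar>\<close>.  Testing it against
\<open>W A = indicator A * w\<close> with a fixed positive integrable weight \<open>w\<close> and adding \<open>B * \<integral>W A\<close> gives a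
set function \<open>\<nu>\<close> with values between \<open>0\<close> and \<open>2 * B * \<integral>W A\<close>.  This bound makes it a measure,
absolutely continuous with respect to the finite measure with density \<open>w\<close>; its Radon--Nikodym
density, shifted back by \<open>B\<close>, represents \<open>T\<close> on the functions \<open>W A\<close> and then on all of \<open>L\<^sup>1\<close>.\<close>

theorem weak_star_limit_exists:
  assumes "sigma_finite_measure M"
    and conv: "\<And>h. integrable M h \<Longrightarrow> pairing_converges h"
  shows "\<exists>G\<in>borel_measurable M. (\<forall>x. \<bar>G x\<bar> \<le> B) \<and>
    (\<forall>h. integrable M h \<longrightarrow> (\<lambda>m. \<integral>x. h x * D m x \<partial>M) \<longlonglongrightarrow> (\<integral>x. h x * G x \<partial>M))"
proof -
  interpret sigma_finite_measure M by fact
  define T where "T h = lim (\<lambda>m. \<integral>x. h x * D m x \<partial>M)" for h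
  have T: "(\<lambda>m. \<integral>x. h x * D m x \<partial>M) \<longlonglongrightarrow> T h" if "integrable M h" for h
    using conv[OF that] by (simp add: pairing_converges_def T_def convergent_LIMSEQ_iff)
  have T_add: "T (\<lambda>x. f x + g x) = T f + T g" if "integrable M f" "integrable M g" for f g
  proof (rule LIMSEQ_unique[OF T])
    show "(\<lambda>m. \<integral>x. (f x + g x) * D m x \<partial>M) \<longlonglongrightarrow> T f + T g"
      using tendsto_add[OF T[OF that(1)] T[OF that(2)]] that by (simp add: distrib_right integrable_D)
  qed (use that in simp)
  have T_scale: "T (\<lambda>x. c * f x) = c * T f" if "integrable M f" for f c
  proof (rule LIMSEQ_unique[OF T])
    show "(\<lambda>m. \<integral>x. (c * f x) * D m x \<partial>M) \<longlonglongrightarrow> c * T f"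
      using tendsto_mult_left[OF T[OF that], of c] by (simp add: mult.assoc)
  qed (use that in simp)
  have T_bound: "\<bar>T h\<bar> \<le> B * (\<integral>x. \<bar>h x\<bar> \<partial>M)" if "integrable M h" for h
    by (rule LIMSEQ_le_const2[OF tendsto_rabs[OF T[OF that]]]) (use abs_pairing_D[OF that] in auto)
  obtain w :: "'a \<Rightarrow> real" where w [measurable]: "w \<in> borel_measurable M"
    and w_pos: "\<And>x. 0 < w x" and w_int: "integrable M w"
    using obtain_positive_integrable_function by metis
  define W where "W A = (\<lambda>x. indicator A x * w x)" for A
  have W_int: "integrable M (W A)" if "A \<in> sets M" for A
    unfolding W_def using integrable_mult_indicator[OF that w_int] by simp
  have W_nonneg: "0 \<le> W A x" for A x
    using w_pos[of x] by (simp add: W_def)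
  define \<nu> where "\<nu> A = T (W A) + B * (\<integral>x. W A x \<partial>M)" for A
  have \<nu>_bounds: "0 \<le> \<nu> A" "\<nu> A \<le> 2 * B * (\<integral>x. W A x \<partial>M)" if "A \<in> sets M" for A
    using T_bound[OF W_int[OF that]] by (simp_all add: \<nu>_def W_nonneg abs_le_iff)
  have \<nu>_Un: "\<nu> (A \<union> A') = \<nu> A + \<nu> A'" if "A \<in> sets M" "A' \<in> sets M" "A \<inter> A' = {}" for A A'
  proof -
    have "W (A \<union> A') = (\<lambda>x. W A x + W A' x)"
      using that(3) by (auto simp: W_def fun_eq_iff indicator_def)
    then show ?thesis using W_int that T_add by (simp add: \<nu>_def algebra_simps)
  qed
  have \<nu>_positive: "positive (sets M) (\<lambda>A. ennreal (\<nu> A))"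
  proof -
    have "W {} = (\<lambda>x. 0 * w x)" by (auto simp: W_def)
    then show ?thesis using T_scale[OF w_int, of 0] by (simp add: positive_def \<nu>_def)
  qed
  define N where "N = measure_of (space M) (sets M) (\<lambda>A. ennreal (\<nu> A))"
  have "countably_additive (sets M) (\<lambda>A. ennreal (\<nu> A))"
  proof (rule sets.empty_continuous_imp_countably_additive)
    show "positive (sets M) (\<lambda>A. ennreal (\<nu> A))" by (rule \<nu>_positive)
    show "additive (sets M) (\<lambda>A. ennreal (\<nu> A))"
      using \<nu>_bounds \<nu>_Un by (auto simp: additive_def simp flip: ennreal_plus)
    show "\<forall>A\<in>sets M. ennreal (\<nu> A) \<noteq> \<infinity>" by simp
    fix A :: "nat \<Rightarrow> 'a set" assume A: "range A \<subseteq> sets M" "decseq A" "(\<Inter>i. A i) = {}"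
    then have [measurable]: "A i \<in> sets M" for i by auto
    have "(\<lambda>i. \<integral>x. W (A i) x \<partial>M) \<longlonglongrightarrow> (\<integral>x. 0 \<partial>M)"
    proof (rule integral_dominated_convergence[OF _ _ w_int])
      show "AE x in M. (\<lambda>i. W (A i) x) \<longlonglongrightarrow> 0"
      proof (intro AE_I2)
        fix x
        have "(\<lambda>i. indicat_real (A i) x) \<longlonglongrightarrow> indicator (\<Inter>i. A i) x"
          using A(2) by (rule LIMSEQ_indicator_decseq)
        then have "(\<lambda>i. indicat_real (A i) x * w x) \<longlonglongrightarrow> indicator (\<Inter>i. A i) x * w x"
          by (rule tendsto_mult_right)
        then show "(\<lambda>i. W (A i) x) \<longlonglongrightarrow> 0" by (simp add: W_def A(3))
      qed
      show "AE x in M. norm (W (A i) x) \<le> w x" for i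
        using w_pos by (auto simp: W_def indicator_def less_imp_le)
    qed (auto simp: W_def)
    then have upper: "(\<lambda>i. 2 * B * (\<integral>x. W (A i) x \<partial>M)) \<longlonglongrightarrow> 0"
      using tendsto_mult_left[of _ 0 sequentially "2 * B"] by simp
    have "(\<lambda>i. \<nu> (A i)) \<longlonglongrightarrow> 0"
      by (rule tendsto_sandwich[OF _ _ tendsto_const upper]) (use \<nu>_bounds in auto)
    then show "(\<lambda>i. ennreal (\<nu> (A i))) \<longlonglongrightarrow> 0" using tendsto_ennrealI by fastforce
  qed
  with \<nu>_positive have N: "emeasure N A = ennreal (\<nu> A)" if "A \<in> sets M" for A
    unfolding N_def using that sets.sigma_algebra_axioms by (intro emeasure_measure_of_sigma)
  have sets_N [simp]: "sets N = sets M" unfolding N_def by simp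
  define M' where "M' = density M (\<lambda>x. ennreal (w x))"
  have M'_int: "integrable M' f \<longleftrightarrow> integrable M (\<lambda>x. w x * f x)"
    and M'_integral: "(\<integral>x. f x \<partial>M') = (\<integral>x. w x * f x \<partial>M)"
    if "f \<in> borel_measurable M" for f :: "'a \<Rightarrow> real"
    using that w_pos by (auto simp: M'_def integrable_density integral_density less_imp_le)
  have sets_M' [simp, measurable_cong]: "sets M' = sets M" by (simp add: M'_def)
  have space_M' [simp]: "space M' = space M" by (simp add: M'_def)
  have M'_W: "emeasure M' A = ennreal (\<integral>x. W A x \<partial>M)" if "A \<in> sets M" for A
  proof -
    have "emeasure M' A = (\<integral>\<^sup>+x. ennreal (W A x) \<partial>M)"
      using that by (auto simp: M'_def emeasure_density W_def intro!: nn_integral_cong split: split_indicator)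
    then show ?thesis using nn_integral_eq_integral[OF W_int[OF that]] W_nonneg by simp
  qed
  interpret M': finite_measure M'
    by (rule finite_measureI) (simp add: M'_W)
  have "absolutely_continuous M' N"
  proof (unfold absolutely_continuous_def, rule subsetI)
    fix A assume "A \<in> null_sets M'"
    then have A: "A \<in> sets M" "(\<integral>x. W A x \<partial>M) = 0"
      using M'_W[of A] W_nonneg by (auto simp: null_sets_def intro: integral_nonneg antisym)
    then show "A \<in> null_sets N" using \<nu>_bounds[OF A(1)] N[OF A(1)] by (auto simp: null_sets_def)
  qed
  then obtain f where f [measurable]: "f \<in> borel_measurable M'" and fN: "density M' f = N"
    using M'.Radon_Nikodym[of N] by auto
  \<comment> \<open>On the set where the density exceeds 2 B its integral exceeds the upper bound for the measure, unless the set is null.\<close>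
  have f_le: "AE x in M'. f x \<le> ennreal (2 * B)"
  proof -
    define A where "A = {x \<in> space M'. ennreal (2 * B) < f x}"
    have A [measurable]: "A \<in> sets M'" unfolding A_def by measurable
    have eq: "(\<integral>\<^sup>+x. f x * indicator A x \<partial>M') = ennreal (\<nu> A)"
      using fN N[of A] A by (simp add: emeasure_density flip: fN)
    have "(\<integral>\<^sup>+x. (f x - ennreal (2 * B)) * indicator A x \<partial>M')
        = (\<integral>\<^sup>+x. f x * indicator A x - ennreal (2 * B) * indicator A x \<partial>M')"
      by (intro nn_integral_cong) (auto split: split_indicator)
    also have "\<dots> = (\<integral>\<^sup>+x. f x * indicator A x \<partial>M') - (\<integral>\<^sup>+x. ennreal (2 * B) * indicator A x \<partial>M')"
      by (intro nn_integral_diff)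
         (auto simp: A_def M'.emeasure_finite ennreal_mult_less_top nn_integral_cmult less_top[symmetric] ennreal_mult_eq_top_iff split: split_indicator)
    also have "\<dots> = ennreal (\<nu> A) - ennreal (2 * B * (\<integral>x. W A x \<partial>M))"
      using A B_nonneg by (simp add: eq nn_integral_cmult M'_W ennreal_mult W_nonneg)
    also have "\<dots> = 0" using \<nu>_bounds[of A] A by (intro diff_eq_0_ennreal ennreal_leI) auto
    finally have "AE x in M'. (f x - ennreal (2 * B)) * indicator A x = 0"
      by (subst (asm) nn_integral_0_iff_AE) auto
    then show ?thesis
      using AE_space by eventually_elim (auto simp: A_def indicator_def split: if_splits dest: ennreal_minus_eq_0)
  qed
  \<comment> \<open>The truncation gives the bound at every point and changes the density on a null set only.\<close>
  define G where "G x = enn2real (min (f x) (ennreal (2 * B))) - B" for x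
  have G [measurable]: "G \<in> borel_measurable M"
    using f unfolding G_def by (simp add: measurable_cong_sets[OF sets_M' refl])
  have G_le: "\<bar>G x\<bar> \<le> B" for x
  proof -
    have "enn2real (min (f x) (ennreal (2 * B))) \<le> 2 * B"
      using B_nonneg by (intro enn2real_leI) auto
    then show ?thesis by (simp add: G_def abs_le_iff)
  qed
  have T_W: "T (W A) = (\<integral>x. W A x * G x \<partial>M)" if A: "A \<in> sets M" for A
  proof -
    have [measurable]: "A \<in> sets M'" using A by simp
    have GB: "0 \<le> (G x + B) * indicator A x" "(G x + B) * indicator A x \<le> 2 * B" for x
      using G_le[of x] B_nonneg by (auto simp: abs_le_iff split: split_indicator)
    have "ennreal (\<nu> A) = (\<integral>\<^sup>+x. f x * indicator A x \<partial>M')"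
      using N[OF A] A by (simp add: emeasure_density flip: fN)
    also have "\<dots> = (\<integral>\<^sup>+x. ennreal ((G x + B) * indicator A x) \<partial>M')"
      using f_le
    proof (intro nn_integral_cong_AE, eventually_elim)
      case (elim x)
      then have "f x < top" using le_less_trans ennreal_less_top by blast
      then show ?case using elim by (simp add: G_def min_def split: split_indicator)
    qed
    also have "\<dots> = ennreal (\<integral>x. (G x + B) * indicator A x \<partial>M')"
    proof (rule nn_integral_eq_integral)
      show "integrable M' (\<lambda>x. (G x + B) * indicator A x)"
        using GB by (intro M'.integrable_const_bound[where B = "2 * B"] AE_I2) auto
      show "AE x in M'. 0 \<le> (G x + B) * indicator A x" using GB by simp
    qed
    finally have "\<nu> A = (\<integral>x. (G x + B) * indicator A x \<partial>M')"
      using \<nu>_bounds(1)[OF A] GB by (subst (asm) ennreal_inj) (auto intro: integral_nonneg_AE)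
    also have "\<dots> = (\<integral>x. W A x * G x + B * W A x \<partial>M)"
      using A by (subst M'_integral) (auto simp: W_def algebra_simps intro!: Bochner_Integration.integral_cong)
    also have "\<dots> = (\<integral>x. W A x * G x \<partial>M) + B * (\<integral>x. W A x \<partial>M)"
      using W_int[OF A] integrable_pairing[OF W_int[OF A] G G_le] by simp
    finally show ?thesis by (simp add: \<nu>_def)
  qed
  have M'_D: "f \<in> borel_measurable M" "integrable M (\<lambda>x. w x * f x)" if "integrable M' f" for f :: "'a \<Rightarrow> real"
  proof -
    show "f \<in> borel_measurable M"
      using borel_measurable_integrable[OF that] by (simp add: measurable_cong_sets[OF sets_M' refl])
    then show "integrable M (\<lambda>x. w x * f x)" using that by (rule M'_int[THEN iffD1])
  qed
  \<comment> \<open>Induction in the finite measure space: its integrable functions, multiplied by w, are the integrable functions of M.\<close>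
  have main: "T (\<lambda>x. w x * h x) = (\<integral>x. (w x * h x) * G x \<partial>M)" if "integrable M' h" for h
    using that
  proof (induction rule: integrable_L1_induct)
    case (indicator A)
    have "w x * indicator A x = W A x" for x by (simp add: W_def)
    then show ?case using T_W[of A] indicator by simp
  next
    case (scale f c)
    then have "integrable M (\<lambda>x. w x * f x)" by (auto intro: M'_D)
    then show ?case using scale T_scale[of "\<lambda>x. w x * f x" c] by (simp add: ac_simps)
  next
    case (add f g)
    then have "integrable M (\<lambda>x. w x * f x)" "integrable M (\<lambda>x. w x * g x)"
      by (auto intro: M'_D)
    then show ?case
      using add(3,4) T_add[of "\<lambda>x. w x * f x" "\<lambda>x. w x * g x"]
        integrable_pairing[of "\<lambda>x. w x * f x", OF _ G G_le] integrable_pairing[of "\<lambda>x. w x * g x", OF _ G G_le]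
      by (simp add: distrib_left[of "w _"] distrib_right)
  next
    case (lim f s)
    have fs: "integrable M (\<lambda>x. w x * f x)" "\<And>i. integrable M (\<lambda>x. w x * s i x)"
      "f \<in> borel_measurable M" "\<And>i. s i \<in> borel_measurable M"
      using lim(1,2) by (auto intro: M'_D)
    define \<epsilon> where "\<epsilon> i = (\<integral>x. \<bar>w x * f x - w x * s i x\<bar> \<partial>M)" for i
    have "\<epsilon> i = (\<integral>x. \<bar>s i x - f x\<bar> \<partial>M')" for i
      using fs w_pos
      by (subst M'_integral) (auto simp: \<epsilon>_def abs_mult abs_minus_commute less_imp_le simp flip: right_diff_distrib intro!: Bochner_Integration.integral_cong)
    then have "\<epsilon> = (\<lambda>i. \<integral>x. \<bar>s i x - f x\<bar> \<partial>M')" by (intro ext)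
    then have \<epsilon>: "\<epsilon> \<longlonglongrightarrow> 0" using lim(3) by simp
    have "\<bar>T (\<lambda>x. w x * f x) - (\<integral>x. (w x * f x) * G x \<partial>M)\<bar> \<le> 2 * B * \<epsilon> i" for i
    proof -
      have "T (\<lambda>x. w x * f x) = T (\<lambda>x. (w x * f x - w x * s i x) + w x * s i x)" by simp
      also have "\<dots> = T (\<lambda>x. w x * f x - w x * s i x) + T (\<lambda>x. w x * s i x)"
        using fs by (intro T_add) auto
      finally have "T (\<lambda>x. w x * f x) - (\<integral>x. (w x * f x) * G x \<partial>M)
          = T (\<lambda>x. w x * f x - w x * s i x) - (\<integral>x. (w x * f x - w x * s i x) * G x \<partial>M)"
        using lim(4)[of i] integrable_pairing[OF _ G G_le] fs by (simp add: left_diff_distrib)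
      moreover have "\<bar>T (\<lambda>x. w x * f x - w x * s i x)\<bar> \<le> B * \<epsilon> i"
        unfolding \<epsilon>_def using fs by (intro T_bound) auto
      moreover have "\<bar>\<integral>x. (w x * f x - w x * s i x) * G x \<partial>M\<bar> \<le> B * \<epsilon> i"
        unfolding \<epsilon>_def using fs by (intro abs_pairing_le G G_le) auto
      ultimately show ?thesis by linarith
    qed
    moreover have "(\<lambda>i. 2 * B * \<epsilon> i) \<longlonglongrightarrow> 0" using tendsto_mult_left[OF \<epsilon>, of "2 * B"] by simp
    ultimately have "\<bar>T (\<lambda>x. w x * f x) - (\<integral>x. (w x * f x) * G x \<partial>M)\<bar> \<le> 0"
      by (intro LIMSEQ_le_const[of "\<lambda>i. 2 * B * \<epsilon> i"]) auto
    then show ?case by simp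
  qed
  have "T h = (\<integral>x. h x * G x \<partial>M)" if h: "integrable M h" for h
  proof -
    have eq: "w x * (h x / w x) = h x" for x using w_pos[of x] by simp
    have quot: "(\<lambda>x. h x / w x) \<in> borel_measurable M" using h w by simp
    have "integrable M' (\<lambda>x. h x / w x)" using h unfolding M'_int[OF quot] eq .
    from main[OF this] show ?thesis unfolding eq .
  qed
  then show ?thesis using G G_le T by (intro bexI[of _ G]) auto
qed

end

text \<open>Open boxes form an intersection-stable generator of the Borel sets, and within a fixed large box the
sets whose indicators have convergent pairings form a Dynkin system: countable disjoint unions are
\<open>L\<^sup>1\<close> limits of finite ones.\<close>

lemma weak_star_limit_from_boxes:
  fixes D :: "nat \<Rightarrow> 'a::euclidean_space \<Rightarrow> real"
  assumes "\<And>m. D m \<in> borel_measurable borel" "\<And>m x. \<bar>D m x\<bar> \<le> B"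
    and box: "\<And>a b. convergent (\<lambda>m. \<integral>x. indicator (box a b) x * D m x \<partial>lborel)"
  shows "\<exists>G\<in>borel_measurable borel. (\<forall>x. \<bar>G x\<bar> \<le> B) \<and>
    (\<forall>h. integrable lborel h \<longrightarrow> (\<lambda>m. \<integral>x. h x * D m x \<partial>lborel) \<longlonglongrightarrow> (\<integral>x. h x * G x \<partial>lborel))"
proof -
  have "0 \<le> B" using assms(2)[of 0 0] by linarith
  then interpret bounded_sequence lborel D B
    using assms by unfold_locales auto
  define K where "K k = (box (- real k *\<^sub>R One) (real k *\<^sub>R One) :: 'a set)" for k :: nat
  have int_K: "integrable lborel (indicat_real (A \<inter> K k))" if "A \<in> sets borel" for A k
  proof -
    have "emeasure lborel (A \<inter> K k) \<le> emeasure lborel (K k)" by (intro emeasure_mono) (auto simp: K_def)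
    also have "\<dots> < \<infinity>" by (simp add: K_def)
    finally show ?thesis using that by (intro integrable_real_indicator) (auto simp: K_def)
  qed
  have bounded_part: "pairing_converges (indicator (A \<inter> K k))" if "A \<in> sets borel" for A k
  proof -
    let ?G = "range (\<lambda>(a, b). box a b :: 'a set)"
    have borel: "sets borel = sigma_sets UNIV ?G" by (subst borel_eq_box) simp
    have "Int_stable ?G"
    proof (rule Int_stableI)
      fix S T assume "S \<in> ?G" "T \<in> ?G"
      then show "S \<inter> T \<in> ?G" unfolding image_iff by (auto simp: box_Int_box) blast
    qed
    moreover have "?G \<subseteq> Pow UNIV" by simp
    moreover have "A \<in> sigma_sets UNIV ?G" using that by (simp flip: borel)
    ultimately show ?thesis
    proof (induction rule: sigma_sets_induct_disjoint)
      case (basic A)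
      then show ?case using box by (auto simp: pairing_converges_def K_def box_Int_box)
    next
      case empty
      then show ?case by (simp add: pairing_converges_def convergent_const)
    next
      case (compl A)
      have "pairing_converges (indicator (UNIV \<inter> K k))"
        using box by (simp add: pairing_converges_def K_def)
      then have "pairing_converges (\<lambda>x. indicator (UNIV \<inter> K k) x + (-1) * indicat_real (A \<inter> K k) x)"
        using compl int_K[of UNIV k] int_K[of A k]
        by (intro pairing_converges_add pairing_converges_scale) (auto simp flip: borel)
      moreover have "(\<lambda>x. indicator (UNIV \<inter> K k) x + (-1) * indicat_real (A \<inter> K k) x) = indicator ((UNIV - A) \<inter> K k)"
        by (auto simp: indicator_def fun_eq_iff)
      ultimately show ?case by simp
    next
      case (union A)
      have A [measurable]: "A i \<in> sets borel" for i using union(2) by (auto simp: borel)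
      define U where "U n = (\<Union>i<n. A i)" for n
      have U [measurable]: "U n \<in> sets borel" for n unfolding U_def by measurable
      have conv: "pairing_converges (indicator (U n \<inter> K k))" for n
      proof (induction n)
        case 0
        then show ?case by (simp add: U_def pairing_converges_def convergent_const)
      next
        case (Suc n)
        have "A n \<inter> A i = {}" if "i < n" for i
          using union(1) that by (simp add: disjoint_family_on_def)
        then have "A n \<inter> U n = {}" by (auto simp: U_def)
        then have "indicat_real (U (Suc n) \<inter> K k) = (\<lambda>x. indicator (U n \<inter> K k) x + indicator (A n \<inter> K k) x)"
          by (auto simp: U_def lessThan_Suc indicator_def fun_eq_iff)
        then show ?case
          using pairing_converges_add[OF int_K[OF U] Suc int_K[OF A] union(3)] by simp
      qed
      have lim: "(\<lambda>n. \<integral>x. \<bar>indicator (U n \<inter> K k) x - indicat_real ((\<Union>i. A i) \<inter> K k) x\<bar> \<partial>lborel) \<longlonglongrightarrow> 0"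
      proof (rule L1_dominated_convergence[OF _ _ int_K[of UNIV k]])
        have "(\<lambda>n. indicat_real (\<Union>i<n. A i) x) \<longlonglongrightarrow> indicator (\<Union>i. A i) x" for x
          by (rule LIMSEQ_indicator_UN)
        then have "(\<lambda>n. indicat_real (U n) x * indicator (K k) x) \<longlonglongrightarrow> indicator (\<Union>i. A i) x * indicator (K k) x" for x
          unfolding U_def by (rule tendsto_mult_right)
        then show "AE x in lborel. (\<lambda>n. indicat_real (U n \<inter> K k) x) \<longlonglongrightarrow> indicator ((\<Union>i. A i) \<inter> K k) x"
          by (simp add: indicator_inter_arith)
      qed (auto simp: indicator_def K_def)
      have "(\<Union>i. A i) \<in> sets borel" by measurable
      then show ?case by (rule pairing_converges_limit[OF int_K[OF U] conv int_K lim])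
    qed
  qed
  have "pairing_converges h" if "integrable lborel h" for h
    using that
  proof (induction rule: integrable_L1_induct)
    case (indicator A)
    then have A: "A \<in> sets borel" "integrable lborel (indicat_real A)" by auto
    have "(\<lambda>k. \<integral>x. \<bar>indicator (A \<inter> K k) x - indicat_real A x\<bar> \<partial>lborel) \<longlonglongrightarrow> 0"
    proof (rule L1_dominated_convergence[OF _ _ A(2)])
      show "AE x in lborel. (\<lambda>k. indicat_real (A \<inter> K k) x) \<longlonglongrightarrow> indicator A x"
      proof (intro AE_I2 tendsto_eventually)
        fix x :: 'a
        obtain k0 :: nat where k0: "norm x < real k0" using reals_Archimedean2 by blast
        have "x \<in> K k" if "k \<ge> k0" for k
        proof -
          have "\<bar>x \<bullet> i\<bar> < real k" if "i \<in> Basis" for i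
            using Basis_le_norm[OF that, of x] k0 \<open>k \<ge> k0\<close> by linarith
          then show ?thesis by (auto simp: K_def mem_box abs_less_iff) (smt (verit))
        qed
        then show "\<forall>\<^sub>F k in sequentially. indicat_real (A \<inter> K k) x = indicator A x"
          unfolding eventually_sequentially by (intro exI[of _ k0]) (auto simp: indicator_def)
      qed
    qed (use A in \<open>auto simp: indicator_def K_def\<close>)
    then show ?case
      using int_K[OF A(1)] bounded_part[OF A(1)] A(2) by (rule pairing_converges_limit[rotated 3])
  next
    case (scale f c)
    then show ?case by (intro pairing_converges_scale)
  next
    case (add f g)
    then show ?case by (intro pairing_converges_add)
  next
    case (lim f s)
    then show ?case by (intro pairing_converges_limit[of s f])
  qed
  then show ?thesis
    using weak_star_limit_exists sigma_finite_lborel by auto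
qed

section \<open>Directional difference quotients and integration by parts\<close>

text \<open>The step is \<open>1 / (n + 1)\<close>; a fixed sequence of steps keeps the quotients inside the reach of
dominated convergence and makes their limit measurable.\<close>

definition diff_quotient :: "'a::real_vector \<Rightarrow> ('a \<Rightarrow> real) \<Rightarrow> nat \<Rightarrow> 'a \<Rightarrow> real" where
  "diff_quotient e f n x = (f (x + e /\<^sub>R real (Suc n)) - f x) * real (Suc n)"

lemma diff_quotient_LIMSEQ:
  assumes "((\<lambda>s. f (x + s *\<^sub>R e)) has_real_derivative c) (at 0)"
  shows "(\<lambda>n. diff_quotient e f n x) \<longlonglongrightarrow> c" "(\<lambda>n. diff_quotient (- e) f n x) \<longlonglongrightarrow> - c"
proof -
  have lim: "(\<lambda>h. (f (x + h *\<^sub>R e) - f x) / h) \<midarrow>0\<rightarrow> c"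
    using DERIV_D[OF assms] by simp
  have "(\<lambda>n. inverse (real (Suc n))) \<longlonglongrightarrow> 0" by (rule LIMSEQ_inverse_real_of_nat)
  then have "filterlim (\<lambda>n. inverse (real (Suc n))) (at 0) sequentially"
    by (simp add: filterlim_at del: of_nat_Suc)
  from filterlim_compose[OF lim this] show "(\<lambda>n. diff_quotient e f n x) \<longlonglongrightarrow> c"
    by (simp add: diff_quotient_def divide_inverse del: of_nat_Suc)
  have "(\<lambda>n. - inverse (real (Suc n))) \<longlonglongrightarrow> 0"
    using tendsto_minus[OF LIMSEQ_inverse_real_of_nat] by simp
  then have "filterlim (\<lambda>n. - inverse (real (Suc n))) (at 0) sequentially"
    by (simp add: filterlim_at del: of_nat_Suc)
  from tendsto_minus[OF filterlim_compose[OF lim this]] show "(\<lambda>n. diff_quotient (- e) f n x) \<longlonglongrightarrow> - c"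
    by (simp add: diff_quotient_def divide_inverse del: of_nat_Suc)
qed

lemma abs_diff_quotient_le:
  assumes "\<And>x s. \<bar>f (x + s *\<^sub>R e) - f x\<bar> \<le> L * \<bar>s\<bar>"
  shows "\<bar>diff_quotient e f n x\<bar> \<le> L" "\<bar>diff_quotient (- e) f n x\<bar> \<le> L"
proof -
  have "\<bar>f (x + inverse (real (Suc n)) *\<^sub>R e) - f x\<bar> * real (Suc n) \<le> L * \<bar>inverse (real (Suc n))\<bar> * real (Suc n)"
    by (intro mult_right_mono assms) simp
  also have "L * \<bar>inverse (real (Suc n))\<bar> * real (Suc n) = L" by simp
  finally show "\<bar>diff_quotient e f n x\<bar> \<le> L"
    by (simp add: diff_quotient_def abs_mult del: of_nat_Suc)
  have "\<bar>f (x + (- inverse (real (Suc n))) *\<^sub>R e) - f x\<bar> * real (Suc n) \<le> L * \<bar>- inverse (real (Suc n))\<bar> * real (Suc n)"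
    by (intro mult_right_mono assms) simp
  also have "L * \<bar>- inverse (real (Suc n))\<bar> * real (Suc n) = L" by simp
  finally show "\<bar>diff_quotient (- e) f n x\<bar> \<le> L"
    by (simp add: diff_quotient_def abs_mult del: of_nat_Suc)
qed

lemma borel_measurable_diff_quotient [measurable]:
  fixes f :: "'a::euclidean_space \<Rightarrow> real"
  assumes [measurable]: "f \<in> borel_measurable borel"
  shows "diff_quotient e f n \<in> borel_measurable borel"
  unfolding diff_quotient_def[abs_def] by measurable

lemma integrable_bounded_support:
  fixes h :: "'a::euclidean_space \<Rightarrow> real"
  assumes "h \<in> borel_measurable borel" "\<And>x. \<bar>h x\<bar> \<le> K * indicator (cball 0 R) x"
  shows "integrable lborel h"
proof (rule Bochner_Integration.integrable_bound)
  show "integrable lborel (\<lambda>x. K * indicat_real (cball (0::'a) R) x)"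
    using emeasure_lborel_cball_finite[of "0::'a" R]
    by (intro integrable_mult_right integrable_real_indicator) (auto simp: less_top)
  show "AE x in lborel. norm (h x) \<le> norm (K * indicat_real (cball (0::'a) R) x)"
    using assms(2) by (auto intro!: AE_I2 intro: order_trans[OF _ abs_ge_self])
qed (use assms in auto)

lemma lborel_integral_translate:
  fixes h :: "'a::euclidean_space \<Rightarrow> real"
  assumes "h \<in> borel_measurable borel"
  shows "(\<integral>x. h (c + x) \<partial>lborel) = (\<integral>x. h x \<partial>lborel)"
  using integral_distr[of "(+) c" lborel borel h] assms by (simp add: lborel_distr_plus)

text \<open>A class of test functions that need derivatives in the single direction \<open>e\<close> only.  It contains
the smooth functions of compact support, but also functions that jump across hyperplanes
parallel to \<open>e\<close>, such as the approximations of indicators of boxes below.\<close>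

definition directional_test :: "'a::euclidean_space \<Rightarrow> ('a \<Rightarrow> real) \<Rightarrow> ('a \<Rightarrow> real) \<Rightarrow> bool" where
  "directional_test e g g' \<longleftrightarrow> g \<in> borel_measurable borel \<and> g' \<in> borel_measurable borel \<and>
     (\<exists>B. \<forall>x. \<bar>g x\<bar> \<le> B) \<and> (\<exists>L. \<forall>x. \<bar>g' x\<bar> \<le> L) \<and> (\<exists>R. \<forall>x. R < norm x \<longrightarrow> g x = 0) \<and>
     (\<forall>x. ((\<lambda>s. g (x + s *\<^sub>R e)) has_real_derivative g' x) (at 0))"

lemma directional_lipschitz:
  fixes g :: "'a::real_normed_vector \<Rightarrow> real"
  assumes "\<And>x. ((\<lambda>s. g (x + s *\<^sub>R e)) has_real_derivative g' x) (at 0)" "\<And>x. \<bar>g' x\<bar> \<le> L"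
  shows "\<bar>g (x + s *\<^sub>R e) - g x\<bar> \<le> L * \<bar>s\<bar>"
proof -
  have "((\<lambda>s. g (x + s *\<^sub>R e)) has_real_derivative g' (x + t *\<^sub>R e)) (at t)" for t
  proof -
    have "((\<lambda>s. g (x + t *\<^sub>R e + (s - t) *\<^sub>R e)) has_real_derivative g' (x + t *\<^sub>R e) * 1) (at t)"
      by (rule DERIV_chain2[where f = "\<lambda>s. g (x + t *\<^sub>R e + s *\<^sub>R e)" and g = "\<lambda>s. s - t"])
         (use assms(1) in \<open>auto intro!: derivative_eq_intros\<close>)
    moreover have "x + t *\<^sub>R e + (s - t) *\<^sub>R e = x + s *\<^sub>R e" for s
      by (simp add: algebra_simps)
    ultimately show ?thesis by simp
  qed
  then have "norm (g (x + s *\<^sub>R e) - g (x + 0 *\<^sub>R e)) \<le> L * norm (s - 0)"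
    using assms(2) by (intro field_differentiable_bound[of UNIV]) auto
  then show ?thesis by simp
qed

text \<open>Summation by parts in the limit: translation invariance moves the difference quotient with step
\<open>e / (n + 1)\<close> from \<open>f\<close> to the one with the opposite step for \<open>g\<close>.  As the quotients are bounded by
Lipschitz constants, both integrands are bounded and supported in a fixed ball, so dominated
convergence applies on both sides.\<close>

lemma integration_by_parts:
  fixes f g :: "'a::euclidean_space \<Rightarrow> real"
  assumes f: "continuous_on UNIV f" "\<And>x s. \<bar>f (x + s *\<^sub>R e) - f x\<bar> \<le> L * \<bar>s\<bar>"
    and f' [measurable]: "f' \<in> borel_measurable borel"
    and f_lim: "AE x in lborel. (\<lambda>n. diff_quotient e f n x) \<longlonglongrightarrow> f' x"
    and g: "directional_test e g g'"
  shows "(\<integral>x. f x * g' x \<partial>lborel) = - (\<integral>x. f' x * g x \<partial>lborel)"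
proof -
  have [measurable]: "f \<in> borel_measurable borel" using f(1) by (rule borel_measurable_continuous_onI)
  have [measurable]: "g \<in> borel_measurable borel" "g' \<in> borel_measurable borel"
    and g_lim: "\<And>x. ((\<lambda>s. g (x + s *\<^sub>R e)) has_real_derivative g' x) (at 0)"
    using g by (auto simp: directional_test_def)
  obtain B L' R where B: "\<And>x. \<bar>g x\<bar> \<le> B" and L': "\<And>x. \<bar>g' x\<bar> \<le> L'"
    and R: "\<And>x. R < norm x \<Longrightarrow> g x = 0"
    using g unfolding directional_test_def by blast
  have B0: "0 \<le> B" using B[of 0] by linarith
  have L0: "0 \<le> L" using f(2)[of 0 1] by linarith
  have L'0: "0 \<le> L'" using L'[of 0] by linarith
  define S where "S = cball (0::'a) (R + norm e)"
  have "bounded (f ` S)"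
    unfolding S_def by (intro compact_imp_bounded compact_continuous_image continuous_on_subset[OF f(1)]) auto
  then obtain K where K: "\<And>x. x \<in> S \<Longrightarrow> \<bar>f x\<bar> \<le> K" unfolding bounded_iff by auto
  have K0: "0 \<le> K" if "x \<in> S" for x using K[OF that] by linarith
  have support: "g x = 0" "g (x - e /\<^sub>R real (Suc n)) = 0" if "x \<notin> S" for x n
  proof -
    have x: "R + norm e < norm x" using that by (simp add: S_def)
    then have "R < norm x" using norm_ge_zero[of e] by linarith
    then show "g x = 0" by (rule R)
    have "norm (e /\<^sub>R real (Suc n)) \<le> norm e"
      using mult_right_mono[of "inverse (real (Suc n))" 1 "norm e"] by (simp add: inverse_le_1_iff del: of_nat_Suc)
    then show "g (x - e /\<^sub>R real (Suc n)) = 0"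
      using x norm_triangle_sub[of x "e /\<^sub>R real (Suc n)"] by (intro R) linarith
  qed
  have g_le: "\<bar>g x\<bar> \<le> B * indicator S x" for x
    using B[of x] support[of x] by (auto simp: indicator_def)
  have gq_le: "\<bar>f x * diff_quotient (- e) g n x\<bar> \<le> K * L' * indicator S x" for n x
  proof (cases "x \<in> S")
    case True
    then show ?thesis
      using K[OF True] abs_diff_quotient_le(2)[of g e L', OF directional_lipschitz[OF g_lim L'], of n x] K0[OF True]
      by (auto simp: abs_mult intro: mult_mono)
  next
    case False
    then show ?thesis using support[OF False] by (simp add: diff_quotient_def)
  qed
  have fq_le: "\<bar>diff_quotient e f n x * g x\<bar> \<le> L * B * indicator S x" for n x
    using abs_diff_quotient_le(1)[of f e L n x, OF f(2)] g_le[of x] L0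
      mult_mono[of "\<bar>diff_quotient e f n x\<bar>" L "\<bar>g x\<bar>" "B * indicator S x"]
    by (simp add: abs_mult mult.assoc)
  have fg_int: "integrable lborel (\<lambda>x. f x * g x)"
  proof (rule integrable_bounded_support)
    show "\<bar>f x * g x\<bar> \<le> K * B * indicator (cball 0 (R + norm e)) x" for x
      using mult_mono[OF K g_le[of x]] support[of x] K0[of x] by (cases "x \<in> S") (auto simp: abs_mult S_def)
  qed simp
  have eq: "(\<integral>x. diff_quotient e f n x * g x \<partial>lborel) = (\<integral>x. f x * diff_quotient (- e) g n x \<partial>lborel)" for n
  proof -
    define c where "c = e /\<^sub>R real (Suc n)"
    define \<delta> where "\<delta> = real (Suc n)"
    have 1: "integrable lborel (\<lambda>x. diff_quotient e f n x * g x)"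
      by (rule integrable_bounded_support[OF _ fq_le[unfolded S_def]]) simp
    have 2: "integrable lborel (\<lambda>x. f x * diff_quotient (- e) g n x)"
      by (rule integrable_bounded_support[OF _ gq_le[unfolded S_def]]) simp
    have "(\<integral>x. diff_quotient e f n x * g x \<partial>lborel) + \<delta> * (\<integral>x. f x * g x \<partial>lborel)
        = (\<integral>x. diff_quotient e f n x * g x + \<delta> * (f x * g x) \<partial>lborel)"
      using 1 fg_int by simp
    also have "\<dots> = (\<integral>x. \<delta> * (f (c + x) * g (c + x - c)) \<partial>lborel)"
      by (intro Bochner_Integration.integral_cong) (auto simp: diff_quotient_def \<delta>_def c_def algebra_simps)
    also have "\<dots> = (\<integral>x. \<delta> * (f x * g (x - c)) \<partial>lborel)"
      by (rule lborel_integral_translate[where h = "\<lambda>x. \<delta> * (f x * g (x - c))"]) simp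
    also have "\<dots> = (\<integral>x. f x * diff_quotient (- e) g n x + \<delta> * (f x * g x) \<partial>lborel)"
      by (intro Bochner_Integration.integral_cong) (auto simp: diff_quotient_def \<delta>_def c_def algebra_simps)
    also have "\<dots> = (\<integral>x. f x * diff_quotient (- e) g n x \<partial>lborel) + \<delta> * (\<integral>x. f x * g x \<partial>lborel)"
      using 2 fg_int by simp
    finally show ?thesis by simp
  qed
  have S_int: "integrable lborel (\<lambda>x. c * indicat_real S x)" for c
    by (rule integrable_bounded_support[of _ "\<bar>c\<bar>" "R + norm e"]) (auto simp: S_def indicator_def)
  have "(\<lambda>n. \<integral>x. diff_quotient e f n x * g x \<partial>lborel) \<longlonglongrightarrow> (\<integral>x. f' x * g x \<partial>lborel)"
  proof (rule integral_dominated_convergence[OF _ _ S_int[of "L * B"]])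
    show "AE x in lborel. (\<lambda>n. diff_quotient e f n x * g x) \<longlonglongrightarrow> f' x * g x"
      using f_lim by eventually_elim (rule tendsto_mult_right)
  qed (use fq_le in auto)
  moreover have "(\<lambda>n. \<integral>x. f x * diff_quotient (- e) g n x \<partial>lborel) \<longlonglongrightarrow> (\<integral>x. f x * - g' x \<partial>lborel)"
  proof (rule integral_dominated_convergence[OF _ _ S_int[of "K * L'"]])
    show "AE x in lborel. (\<lambda>n. f x * diff_quotient (- e) g n x) \<longlonglongrightarrow> f x * - g' x"
      using diff_quotient_LIMSEQ(2)[OF g_lim] by (intro AE_I2 tendsto_mult_left)
  qed (use gq_le in auto)
  ultimately have "(\<integral>x. f' x * g x \<partial>lborel) = (\<integral>x. f x * - g' x \<partial>lborel)"
    using eq LIMSEQ_unique by simp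
  then show ?thesis by simp
qed

section \<open>Smooth approximation of boxes in one direction\<close>

text \<open>A continuously differentiable function that vanishes for \<open>t \<le> 0\<close> and increases to \<open>1\<close> as \<open>t\<close> tends
to infinity.\<close>

definition ramp :: "real \<Rightarrow> real" where
  "ramp t = (max 0 t)\<^sup>2 / (1 + (max 0 t)\<^sup>2)"

definition ramp' :: "real \<Rightarrow> real" where
  "ramp' t = 2 * max 0 t / (1 + (max 0 t)\<^sup>2)\<^sup>2"

lemma ramp_bounds: "0 \<le> ramp t" "ramp t \<le> 1"
proof -
  have "0 < 1 + (max 0 t)\<^sup>2" by (simp add: add_pos_nonneg)
  then show "0 \<le> ramp t" "ramp t \<le> 1" by (simp_all add: ramp_def)
qed

lemma ramp_nonpos: "t \<le> 0 \<Longrightarrow> ramp t = 0"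
  by (simp add: ramp_def)

lemma abs_ramp'_le: "\<bar>ramp' t\<bar> \<le> 1"
proof -
  define s where "s = max 0 t"
  have "0 \<le> s" by (simp add: s_def)
  have "0 \<le> (1 - s)\<^sup>2" by simp
  then have "2 * s \<le> 1 + s\<^sup>2" by (simp add: power2_eq_square algebra_simps)
  also have "\<dots> \<le> (1 + s\<^sup>2)\<^sup>2" using self_le_power[of "1 + s\<^sup>2" 2] by simp
  finally have "2 * s / (1 + s\<^sup>2)\<^sup>2 \<le> 1" by (simp add: divide_le_eq_1 add_pos_nonneg)
  then show ?thesis using \<open>0 \<le> s\<close> by (simp add: ramp'_def flip: s_def)
qed

lemma square_positive_part_DERIV:
  "((\<lambda>t. (max 0 t)\<^sup>2) has_real_derivative 2 * max 0 t) (at (t::real))"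
proof -
  consider "t < 0" | "t = 0" | "0 < t" by linarith
  then show ?thesis
  proof cases
    case 1
    show ?thesis
      by (rule has_field_derivative_transform_within_open[of "\<lambda>_. 0" _ _ "{..<0}"]) (use 1 in auto)
  next
    case 2
    have "(\<lambda>h::real. (max 0 h)\<^sup>2 / h) \<midarrow>0\<rightarrow> 0"
    proof (rule Lim_null_comparison)
      show "\<forall>\<^sub>F h in at 0. norm ((max 0 h)\<^sup>2 / h) \<le> \<bar>h :: real\<bar>"
        by (intro always_eventually) (auto simp: max_def power2_eq_square)
      show "((\<lambda>h. \<bar>h :: real\<bar>) \<longlongrightarrow> 0) (at 0)" by (rule tendsto_rabs_zero) simp
    qed
    then show ?thesis using 2 by (simp add: DERIV_def)
  next
    case 3
    show ?thesis
      by (rule has_field_derivative_transform_within_open[of "\<lambda>t. t\<^sup>2" _ _ "{0<..}"])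
         (use 3 in \<open>auto intro!: derivative_eq_intros\<close>)
  qed
qed

lemma ramp_DERIV: "(ramp has_real_derivative ramp' t) (at t)"
proof -
  have "1 + (max 0 t)\<^sup>2 \<noteq> 0" by (simp add: add_pos_nonneg less_imp_neq[symmetric])
  from DERIV_divide[OF square_positive_part_DERIV DERIV_add[OF DERIV_const square_positive_part_DERIV] this]
  show ?thesis
    unfolding ramp_def[abs_def] ramp'_def by (simp add: power2_eq_square algebra_simps)
qed

lemma ramp_LIMSEQ:
  assumes "0 < t"
  shows "(\<lambda>k. ramp (real k * t)) \<longlonglongrightarrow> 1"
proof -
  have "(\<lambda>k. (real k * t)\<^sup>2 / (1 + (real k * t)\<^sup>2)) \<longlonglongrightarrow> 1"
    using assms by real_asymp
  moreover have "max 0 (real k * t) = real k * t" for k using assms by simp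
  ultimately show ?thesis by (simp only: ramp_def)
qed

lemma borel_measurable_ramp [measurable]: "ramp \<in> borel_measurable borel"
  unfolding ramp_def[abs_def] by measurable

lemma borel_measurable_ramp' [measurable]: "ramp' \<in> borel_measurable borel"
  unfolding ramp'_def[abs_def] by measurable

definition slab :: "'a::euclidean_space \<Rightarrow> 'a \<Rightarrow> 'a \<Rightarrow> 'a set" where
  "slab e a b = {x. \<forall>i\<in>Basis - {e}. a \<bullet> i < x \<bullet> i \<and> x \<bullet> i < b \<bullet> i}"

text \<open>The indicator of \<open>box a b\<close> with its two faces orthogonal to \<open>e\<close> smoothed out; the other faces are
kept sharp because no derivative is taken across them.\<close>

definition box_ramp :: "'a::euclidean_space \<Rightarrow> 'a \<Rightarrow> 'a \<Rightarrow> nat \<Rightarrow> 'a \<Rightarrow> real" where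
  "box_ramp e a b k x =
     indicator (slab e a b) x * (ramp (real k * (x \<bullet> e - a \<bullet> e)) * ramp (real k * (b \<bullet> e - x \<bullet> e)))"

definition box_ramp' :: "'a::euclidean_space \<Rightarrow> 'a \<Rightarrow> 'a \<Rightarrow> nat \<Rightarrow> 'a \<Rightarrow> real" where
  "box_ramp' e a b k x = indicator (slab e a b) x *
     (real k * (ramp' (real k * (x \<bullet> e - a \<bullet> e)) * ramp (real k * (b \<bullet> e - x \<bullet> e))
      - ramp (real k * (x \<bullet> e - a \<bullet> e)) * ramp' (real k * (b \<bullet> e - x \<bullet> e))))"

lemma slab_measurable [measurable]: "slab e a b \<in> sets borel"
  unfolding slab_def by measurable

lemma mem_box_slab: "e \<in> Basis \<Longrightarrow> x \<in> box a b \<longleftrightarrow> x \<in> slab e a b \<and> a \<bullet> e < x \<bullet> e \<and> x \<bullet> e < b \<bullet> e"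
  unfolding slab_def mem_box by auto

lemma slab_translate: "e \<in> Basis \<Longrightarrow> x + s *\<^sub>R e \<in> slab e a b \<longleftrightarrow> x \<in> slab e a b"
proof -
  assume "e \<in> Basis"
  then have "e \<bullet> i = 0" if "i \<in> Basis - {e}" for i
    using that by (auto simp: inner_not_same_Basis)
  then show ?thesis by (simp add: slab_def inner_add_left)
qed

lemma box_ramp_bounds:
  assumes "e \<in> Basis"
  shows "0 \<le> box_ramp e a b k x" "box_ramp e a b k x \<le> indicator (box a b) x"
proof -
  show "0 \<le> box_ramp e a b k x" by (simp add: box_ramp_def ramp_bounds)
  show "box_ramp e a b k x \<le> indicator (box a b) x"
  proof (cases "x \<in> box a b")
    case True
    then show ?thesis
      using mult_mono[OF ramp_bounds(2) ramp_bounds(2)] ramp_bounds by (simp add: box_ramp_def indicator_def)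
  next
    case False
    then have "x \<notin> slab e a b \<or> x \<bullet> e - a \<bullet> e \<le> 0 \<or> b \<bullet> e - x \<bullet> e \<le> 0"
      using mem_box_slab[OF assms] by auto
    then show ?thesis
      by (auto simp: box_ramp_def False ramp_nonpos mult_nonneg_nonpos)
  qed
qed

lemma box_ramp_LIMSEQ:
  assumes "e \<in> Basis"
  shows "(\<lambda>k. box_ramp e a b k x) \<longlonglongrightarrow> indicator (box a b) x"
proof (cases "x \<in> box a b")
  case True
  then have x: "x \<in> slab e a b" "0 < x \<bullet> e - a \<bullet> e" "0 < b \<bullet> e - x \<bullet> e"
    using mem_box_slab[OF assms] by auto
  show ?thesis
    using tendsto_mult[OF ramp_LIMSEQ[OF x(2)] ramp_LIMSEQ[OF x(3)]] x(1) True by (simp add: box_ramp_def)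
next
  case False
  then have "box_ramp e a b k x = 0" for k
    using box_ramp_bounds[OF assms, of a b k x] by simp
  then show ?thesis using False by simp
qed

lemma box_ramp_test:
  assumes e: "e \<in> Basis"
  shows "directional_test e (box_ramp e a b k) (box_ramp' e a b k)"
  unfolding directional_test_def
proof (intro conjI allI)
  show "box_ramp e a b k \<in> borel_measurable borel" "box_ramp' e a b k \<in> borel_measurable borel"
    unfolding box_ramp_def[abs_def] box_ramp'_def[abs_def] by measurable
  have "\<bar>box_ramp e a b k x\<bar> \<le> 1" for x
    using box_ramp_bounds[OF e, of a b k x] by (cases "x \<in> box a b") auto
  then show "\<exists>B. \<forall>x. \<bar>box_ramp e a b k x\<bar> \<le> B" by blast
  have "\<bar>box_ramp' e a b k x\<bar> \<le> real k * 2" for x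
  proof -
    have "\<bar>ramp' s * ramp t\<bar> \<le> 1" "\<bar>ramp t * ramp' s\<bar> \<le> 1" for s t
      using mult_mono[OF abs_ramp'_le[of s] ramp_bounds(2)[of t]] ramp_bounds[of t]
      by (simp_all add: abs_mult mult.commute)
    then have "\<bar>ramp' (real k * (x \<bullet> e - a \<bullet> e)) * ramp (real k * (b \<bullet> e - x \<bullet> e))
      - ramp (real k * (x \<bullet> e - a \<bullet> e)) * ramp' (real k * (b \<bullet> e - x \<bullet> e))\<bar> \<le> 1 + 1"
      by (intro order_trans[OF abs_triangle_ineq4] add_mono)
    then show ?thesis
      by (auto simp: box_ramp'_def abs_mult indicator_def intro!: mult_left_mono)
  qed
  then show "\<exists>L. \<forall>x. \<bar>box_ramp' e a b k x\<bar> \<le> L" by blast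
  obtain R where R: "\<And>x. x \<in> box a b \<Longrightarrow> norm x \<le> R"
    using bounded_box[of a b] unfolding bounded_iff by blast
  have "box_ramp e a b k x = 0" if "R < norm x" for x
    using box_ramp_bounds[OF e, of a b k x] R[of x] that by (cases "x \<in> box a b") auto
  then show "\<exists>R. \<forall>x. R < norm x \<longrightarrow> box_ramp e a b k x = 0" by blast
  fix x
  have ind: "indicator (slab e a b) (x + s *\<^sub>R e) = (indicator (slab e a b) x :: real)" for s
    using slab_translate[OF e] by (simp add: indicator_def)
  have inner: "(x + s *\<^sub>R e) \<bullet> e = x \<bullet> e + s" for s
    using e by (simp add: inner_add_left)
  have "((\<lambda>s. ramp (real k * (x \<bullet> e + s - a \<bullet> e))) has_real_derivative
      ramp' (real k * (x \<bullet> e + 0 - a \<bullet> e)) * real k) (at 0)"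
    by (rule DERIV_chain2[OF ramp_DERIV]) (auto intro!: derivative_eq_intros)
  moreover have "((\<lambda>s. ramp (real k * (b \<bullet> e - (x \<bullet> e + s)))) has_real_derivative
      ramp' (real k * (b \<bullet> e - (x \<bullet> e + 0))) * - real k) (at 0)"
    by (rule DERIV_chain2[OF ramp_DERIV]) (auto intro!: derivative_eq_intros)
  ultimately have "((\<lambda>s. ramp (real k * (x \<bullet> e + s - a \<bullet> e)) * ramp (real k * (b \<bullet> e - (x \<bullet> e + s)))) has_real_derivative
      ramp' (real k * (x \<bullet> e + 0 - a \<bullet> e)) * real k * ramp (real k * (b \<bullet> e - (x \<bullet> e + 0)))
      + ramp' (real k * (b \<bullet> e - (x \<bullet> e + 0))) * - real k * ramp (real k * (x \<bullet> e + 0 - a \<bullet> e))) (at 0)"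
    by (rule DERIV_mult)
  from DERIV_cmult[OF this, of "indicator (slab e a b) x"]
  show "((\<lambda>s. box_ramp e a b k (x + s *\<^sub>R e)) has_real_derivative box_ramp' e a b k x) (at 0)"
    unfolding box_ramp_def box_ramp'_def ind inner by (simp add: algebra_simps)
qed

section \<open>Weak derivatives of limits of nonexpansive functions\<close>

text \<open>The region \<open>R < norm x\<close> is open, so the difference quotients vanish eventually.\<close>

lemma derivative_outside_support:
  fixes g :: "'a::real_normed_vector \<Rightarrow> real"
  assumes deriv: "((\<lambda>s. g (x + s *\<^sub>R e)) has_real_derivative c) (at 0)"
    and R: "\<And>x. R < norm x \<Longrightarrow> g x = 0" and x: "R < norm x"
  shows "c = 0"
proof -
  have "(\<lambda>n. norm (x + inverse (real (Suc n)) *\<^sub>R e)) \<longlonglongrightarrow> norm (x + 0 *\<^sub>R e)"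
    by (intro tendsto_intros LIMSEQ_inverse_real_of_nat)
  then have "\<forall>\<^sub>F n in sequentially. R < norm (x + inverse (real (Suc n)) *\<^sub>R e)"
    using x by (intro order_tendstoD(1)) auto
  then have "\<forall>\<^sub>F n in sequentially. diff_quotient e g n x = 0"
    by eventually_elim (simp add: diff_quotient_def R x)
  then have "(\<lambda>n. diff_quotient e g n x) \<longlonglongrightarrow> 0" by (rule tendsto_eventually)
  then show ?thesis using diff_quotient_LIMSEQ(1)[OF deriv] LIMSEQ_unique by blast
qed

text \<open>Integrated against \<open>directional_test\<close> functions the derivatives \<open>D m\<close> become integrals of \<open>f m\<close>
itself, which converge.  These test functions include \<open>box_ramp\<close>, and an \<open>L\<^sup>1\<close> limit leads from
there to indicators of boxes, the input of the preceding section.  The integration by parts formula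
passes to the limit and identifies \<open>G\<close> as the weak derivative of \<open>p\<close>.\<close>

lemma weak_derivative_limit:
  fixes f :: "nat \<Rightarrow> 'a::euclidean_space \<Rightarrow> real"
  assumes e: "e \<in> Basis"
    and f: "\<And>m x y. \<bar>f m x - f m y\<bar> \<le> dist x y"
    and D: "\<And>m. D m \<in> borel_measurable borel" "\<And>m x. \<bar>D m x\<bar> \<le> B"
      "\<And>m. AE x in lborel. (\<lambda>n. diff_quotient e (f m) n x) \<longlonglongrightarrow> D m x"
    and p: "\<And>x. (\<lambda>m. f m x) \<longlonglongrightarrow> p x"
  shows "\<exists>G\<in>borel_measurable borel. (\<forall>x. \<bar>G x\<bar> \<le> B) \<and>
    (\<forall>h. integrable lborel h \<longrightarrow> (\<lambda>m. \<integral>x. h x * D m x \<partial>lborel) \<longlonglongrightarrow> (\<integral>x. h x * G x \<partial>lborel)) \<and>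
    (\<forall>g g'. directional_test e g g' \<longrightarrow> (\<integral>x. p x * g' x \<partial>lborel) = - (\<integral>x. G x * g x \<partial>lborel))"
proof -
  have "1-lipschitz_on UNIV (f m)" for m
    using f by (simp add: lipschitz_on_def dist_real_def)
  then have f_cont: "continuous_on UNIV (f m)" for m by (rule lipschitz_on_continuous_on)
  then have f_meas [measurable]: "f m \<in> borel_measurable borel" for m by (rule borel_measurable_continuous_onI)
  have p_meas [measurable]: "p \<in> borel_measurable borel"
    using p f_meas by (rule borel_measurable_LIMSEQ_metric[rotated])
  have f_dir: "\<bar>f m (x + s *\<^sub>R e) - f m x\<bar> \<le> 1 * \<bar>s\<bar>" for m x s
    using f[of m "x + s *\<^sub>R e" x] e by (simp add: dist_norm)
  note parts = integration_by_parts[OF f_cont f_dir D(1) D(3)]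
  obtain A where A: "\<And>m. \<bar>f m 0\<bar> \<le> A"
    using convergent_imp_bounded[of "\<lambda>m. f m 0"] p[of 0] unfolding convergent_def bounded_iff by auto
  have f_le: "\<bar>f m x\<bar> \<le> A + norm x" for m x
    using A[of m] f[of m x 0] by simp
  have conv: "(\<lambda>m. \<integral>x. f m x * g' x \<partial>lborel) \<longlonglongrightarrow> (\<integral>x. p x * g' x \<partial>lborel)"
    if g: "directional_test e g g'" for g g'
  proof -
    have [measurable]: "g' \<in> borel_measurable borel" using g by (simp add: directional_test_def)
    obtain L R where L: "\<And>x. \<bar>g' x\<bar> \<le> L" and R: "\<And>x. R < norm x \<Longrightarrow> g x = 0"
      using g unfolding directional_test_def by blast
    have g'_0: "g' x = 0" if "R < norm x" for x
      using derivative_outside_support[of g x e "g' x" R] g R that by (auto simp: directional_test_def)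
    show ?thesis
    proof (rule integral_dominated_convergence)
      show "integrable lborel (\<lambda>x. (A + R) * L * indicat_real (cball (0::'a) R) x)"
        by (rule integrable_bounded_support[of _ "\<bar>(A + R) * L\<bar>" R]) (auto simp: indicator_def)
      show "AE x in lborel. norm (f m x * g' x) \<le> (A + R) * L * indicat_real (cball 0 R) x" for m
      proof (intro AE_I2)
        fix x
        show "norm (f m x * g' x) \<le> (A + R) * L * indicat_real (cball 0 R) x"
        proof (cases "norm x \<le> R")
          case True
          have "\<bar>f m x\<bar> * \<bar>g' x\<bar> \<le> (A + R) * L"
            using True f_le[of m x] L[of x] by (intro mult_mono) auto
          then show ?thesis using True by (simp add: abs_mult)
        next
          case False
          then have "g' x = 0" using g'_0 by simp
          then show ?thesis using False by simp
        qed
      qed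
      show "AE x in lborel. (\<lambda>m. f m x * g' x) \<longlonglongrightarrow> p x * g' x"
        using p by (intro AE_I2 tendsto_mult_right)
    qed auto
  qed
  have "0 \<le> B" using D(2)[of 0 0] by linarith
  then interpret bounded_sequence lborel D B
    using D by unfold_locales auto
  have test_conv: "pairing_converges g" if g: "directional_test e g g'" for g g'
  proof -
    have "(\<integral>x. g x * D m x \<partial>lborel) = - (\<integral>x. f m x * g' x \<partial>lborel)" for m
      using parts[OF g, of m] by (simp add: mult.commute)
    then show ?thesis
      unfolding pairing_converges_def convergent_def using tendsto_minus[OF conv[OF g]] by auto
  qed
  have ind_box: "integrable lborel (indicat_real (box a b))" for a b :: 'a
    using emeasure_lborel_box_finite[of a b] by (intro integrable_real_indicator) (auto simp: less_top)
  have ramp_int: "integrable lborel (box_ramp e a b k)" for a b k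
    by (rule Bochner_Integration.integrable_bound[OF ind_box[of a b]])
       (use box_ramp_bounds[OF e] box_ramp_test[OF e] in \<open>auto simp: directional_test_def\<close>)
  have "pairing_converges (indicator (box a b))" for a b
  proof (rule pairing_converges_limit)
    show "integrable lborel (box_ramp e a b k)" for k by (rule ramp_int)
    show "pairing_converges (box_ramp e a b k)" for k by (rule test_conv[OF box_ramp_test[OF e]])
    show "integrable lborel (indicat_real (box a b))" by (rule ind_box)
    show "(\<lambda>k. \<integral>x. \<bar>box_ramp e a b k x - indicat_real (box a b) x\<bar> \<partial>lborel) \<longlonglongrightarrow> 0"
      by (rule L1_dominated_convergence[OF _ _ ind_box[of a b]])
         (use box_ramp_bounds[OF e] box_ramp_LIMSEQ[OF e] box_ramp_test[OF e] in \<open>auto simp: directional_test_def\<close>)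
  qed
  then obtain G where G: "G \<in> borel_measurable borel" "\<And>x. \<bar>G x\<bar> \<le> B"
    "\<And>h. integrable lborel h \<Longrightarrow> (\<lambda>m. \<integral>x. h x * D m x \<partial>lborel) \<longlonglongrightarrow> (\<integral>x. h x * G x \<partial>lborel)"
    using weak_star_limit_from_boxes[of D B] D unfolding pairing_converges_def by blast
  have "(\<integral>x. p x * g' x \<partial>lborel) = - (\<integral>x. G x * g x \<partial>lborel)" if g: "directional_test e g g'" for g g'
  proof -
    obtain C R where C: "\<And>x. \<bar>g x\<bar> \<le> C" and R: "\<And>x. R < norm x \<Longrightarrow> g x = 0" and [measurable]: "g \<in> borel_measurable borel"
      using g unfolding directional_test_def by blast
    have "\<bar>g x\<bar> \<le> C * indicator (cball 0 R) x" for x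
      using C[of x] R[of x] by (cases "R < norm x") (auto simp: indicator_def)
    then have "integrable lborel g" by (intro integrable_bounded_support) auto
    then have "(\<lambda>m. \<integral>x. g x * D m x \<partial>lborel) \<longlonglongrightarrow> (\<integral>x. g x * G x \<partial>lborel)" by (rule G(3))
    moreover have "(\<integral>x. g x * D m x \<partial>lborel) = - (\<integral>x. f m x * g' x \<partial>lborel)" for m
      using parts[OF g, of m] by (simp add: mult.commute)
    ultimately have "(\<integral>x. g x * G x \<partial>lborel) = - (\<integral>x. p x * g' x \<partial>lborel)"
      using tendsto_minus[OF conv[OF g]] LIMSEQ_unique by simp
    then show ?thesis by (simp add: mult.commute)
  qed
  then show ?thesis using G by blast
qed

section \<open>Weak-star convergence of fold compositions\<close>

lemma has_derivative_imp_directional: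
  assumes "(f has_derivative D) (at x)"
  shows "((\<lambda>s. f (x + s *\<^sub>R e)) has_real_derivative D e) (at 0)"
proof -
  have "((\<lambda>s. f (x + s *\<^sub>R e)) has_derivative (\<lambda>s. D (s *\<^sub>R e))) (at 0)"
    by (rule has_derivative_compose[of "\<lambda>s. x + s *\<^sub>R e" "\<lambda>s. s *\<^sub>R e" 0 UNIV f D])
       (use assms in \<open>auto intro!: derivative_eq_intros\<close>)
  moreover have "(\<lambda>s. D (s *\<^sub>R e)) = (*) (D e)"
    using linear_scale[OF has_derivative_linear[OF assms]] by (auto simp: fun_eq_iff mult.commute)
  ultimately show ?thesis by (simp add: has_field_derivative_def)
qed

lemma bounded_of_continuous_support:
  fixes g :: "'a::euclidean_space \<Rightarrow> real"
  assumes "continuous_on UNIV g" "\<And>x. R < norm x \<Longrightarrow> g x = 0"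
  shows "\<exists>B. \<forall>x. \<bar>g x\<bar> \<le> B"
proof -
  have "bounded (g ` cball 0 R)"
    by (intro compact_imp_bounded compact_continuous_image continuous_on_subset[OF assms(1)]) auto
  then obtain B where "\<forall>x\<in>cball 0 R. \<bar>g x\<bar> \<le> B" unfolding bounded_iff by auto
  then have B: "\<bar>g x\<bar> \<le> B" if "norm x \<le> R" for x using that by simp
  have "\<bar>g x\<bar> \<le> max 0 B" for x
    using B[of x] assms(2)[of x] by (cases "norm x \<le> R") auto
  then show ?thesis by blast
qed

lemma test_function_directional:
  fixes \<phi> :: "real^'n::finite \<Rightarrow> real"
  assumes "test_function \<phi>"
  shows "directional_test (axis j 1) \<phi> (partial_derivative j \<phi>)"
proof -
  have "C_k (Suc 0) \<phi>" using assms by (simp only: test_function_def)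
  then have diff: "\<phi> differentiable_on UNIV" and cont': "continuous_on UNIV (partial_derivative j \<phi>)"
    by auto
  have cont: "continuous_on UNIV \<phi>" using diff by (rule differentiable_imp_continuous_on)
  have deriv: "((\<lambda>s. \<phi> (x + s *\<^sub>R axis j 1)) has_real_derivative partial_derivative j \<phi> x) (at 0)" for x
    unfolding partial_derivative_def using diff
    by (intro has_derivative_imp_directional) (simp add: differentiable_on_def frechet_derivative_works[symmetric])
  have "bounded (closure {x. \<phi> x \<noteq> 0})" using assms by (simp add: test_function_def compact_imp_bounded)
  then obtain R where R: "\<And>x. x \<in> closure {x. \<phi> x \<noteq> 0} \<Longrightarrow> norm x \<le> R" unfolding bounded_iff by auto
  have out: "\<phi> x = 0" if "R < norm x" for x
    using R[of x] that closure_subset[of "{x. \<phi> x \<noteq> 0}"] by fastforce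
  have out': "partial_derivative j \<phi> x = 0" if "R < norm x" for x
    using derivative_outside_support[OF deriv out that] .
  show ?thesis
    unfolding directional_test_def
    using deriv out bounded_of_continuous_support[OF cont out] bounded_of_continuous_support[OF cont' out']
      cont cont' borel_measurable_continuous_onI by blast
qed

lemma borel_measurable_matrix:
  fixes M :: "'a \<Rightarrow> real^'n::finite^'m::finite"
  assumes "\<And>i j. (\<lambda>x. M x $ i $ j) \<in> borel_measurable N"
  shows "M \<in> borel_measurable N"
  unfolding borel_measurable_euclidean_space[of M]
  using assms by (auto simp: Basis_vec_def inner_axis)

lemma borel_measurable_vec_component [measurable]:
  "(\<lambda>x::real^'n::finite. x $ i) \<in> borel_measurable borel"
  by (intro borel_measurable_continuous_onI continuous_intros)

lemma norm_matrix_le: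
  fixes M :: "real^'n::finite^'m::finite"
  assumes "\<And>i j. \<bar>M $ i $ j\<bar> \<le> B"
  shows "norm M \<le> real CARD('m) * (real CARD('n) * B)"
proof -
  have "norm (M $ i) \<le> real CARD('n) * B" for i
    using norm_le_l1_cart[of "M $ i"] sum_bounded_above[of UNIV "\<lambda>j. \<bar>M $ i $ j\<bar>" B] assms
    by (intro order_trans[OF norm_le_l1_cart]) simp
  then have "(\<Sum>i\<in>UNIV. norm (M $ i)) \<le> real CARD('m) * (real CARD('n) * B)"
    using sum_bounded_above[of "UNIV :: 'm set" "\<lambda>i. norm (M $ i)" "real CARD('n) * B"] by simp
  moreover have "norm M \<le> (\<Sum>i\<in>UNIV. norm (M $ i))"
    unfolding norm_vec_def by (rule L2_set_le_sum) simp
  ultimately show ?thesis by simp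
qed

lemma locally_integrable_of_bounded:
  fixes f :: "'a::euclidean_space \<Rightarrow> 'b::euclidean_space"
  assumes "f \<in> borel_measurable borel" "\<And>x. norm (f x) \<le> A + B * norm x" "0 \<le> B"
  shows "locally_integrable f"
  unfolding locally_integrable_def set_integrable_def
proof (intro allI impI)
  fix K :: "'a set" assume K: "compact K"
  have [measurable]: "K \<in> sets borel" using K by (simp add: compact_imp_closed)
  obtain R where R: "\<And>x. x \<in> K \<Longrightarrow> norm x \<le> R"
    using compact_imp_bounded[OF K] unfolding bounded_iff by auto
  have "integrable lborel (\<lambda>x. indicator K x *\<^sub>R f x)"
  proof (rule Bochner_Integration.integrable_bound)
    show "integrable lborel (\<lambda>x. (A + B * R) * indicat_real K x)"
      using emeasure_bounded_finite[OF compact_imp_bounded[OF K]] by simp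
    show "AE x in lborel. norm (indicator K x *\<^sub>R f x) \<le> norm ((A + B * R) * indicat_real K x)"
    proof (intro AE_I2)
      fix x
      have "norm (f x) \<le> A + B * R" if "x \<in> K"
        using assms(2)[of x] mult_left_mono[OF R[OF that] assms(3)] by linarith
      then show "norm (indicator K x *\<^sub>R f x) \<le> norm ((A + B * R) * indicat_real K x)"
        by (auto simp: indicator_def)
    qed
  qed (use assms(1) in simp)
  then show "integrable lebesgue (\<lambda>x. indicator K x *\<^sub>R f x)"
    using assms(1) by (subst integrable_completion) auto
qed

lemma borel_measurable_lebesgue_on_of_borel:
  "f \<in> borel_measurable borel \<Longrightarrow> f \<in> borel_measurable (lebesgue_on \<Omega>)"
  by (intro measurable_restrict_space1 measurable_completion) simp

lemma L_infinity_of_bounded: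
  fixes f :: "'a::euclidean_space \<Rightarrow> 'b::euclidean_space"
  assumes "f \<in> borel_measurable borel" "\<And>x. norm (f x) \<le> A + B * norm x" "0 \<le> B" "bounded \<Omega>"
  shows "L_infinity \<Omega> f"
proof -
  obtain R where R: "\<And>x. x \<in> \<Omega> \<Longrightarrow> norm x \<le> R"
    using assms(4) unfolding bounded_iff by auto
  have "norm (f x) \<le> A + B * R" if "x \<in> \<Omega>" for x
    using assms(2)[of x] mult_left_mono[OF R[OF that] assms(3)] by linarith
  then have "AE x in lebesgue_on \<Omega>. norm (f x) \<le> A + B * R"
    by (intro AE_I2) (simp add: space_restrict_space)
  then show ?thesis
    using borel_measurable_lebesgue_on_of_borel[OF assms(1)] by (auto simp: L_infinity_def)
qed

lemma weak_star_L_infinity_of_pointwise: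
  fixes f :: "nat \<Rightarrow> 'a::euclidean_space \<Rightarrow> 'b::euclidean_space"
  assumes "\<And>m. f m \<in> borel_measurable borel" "g \<in> borel_measurable borel"
    and le: "\<And>m x. norm (f m x) \<le> A + B * norm x" "\<And>x. norm (g x) \<le> A + B * norm x" "0 \<le> B"
    and lim: "\<And>x. (\<lambda>m. f m x) \<longlonglongrightarrow> g x" and \<Omega>: "bounded \<Omega>"
  shows "weak_star_L_infinity \<Omega> f g"
  unfolding weak_star_L_infinity_def
proof (intro conjI allI impI)
  show "L_infinity \<Omega> (f m)" for m using assms by (intro L_infinity_of_bounded)
  show "L_infinity \<Omega> g" using assms by (intro L_infinity_of_bounded)
  fix h :: "'a \<Rightarrow> real" assume h: "integrable (lebesgue_on \<Omega>) h"
  obtain R where R: "\<And>x. x \<in> \<Omega> \<Longrightarrow> norm x \<le> R"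
    using \<Omega> unfolding bounded_iff by auto
  have f_le: "norm (f m x) \<le> A + B * R" if "x \<in> \<Omega>" for x m
    using le(1)[of m x] mult_left_mono[OF R[OF that] le(3)] by linarith
  show "(\<lambda>m. LINT x|lebesgue_on \<Omega>. h x *\<^sub>R f m x) \<longlonglongrightarrow> (LINT x|lebesgue_on \<Omega>. h x *\<^sub>R g x)"
  proof (rule integral_dominated_convergence)
    show "integrable (lebesgue_on \<Omega>) (\<lambda>x. \<bar>h x\<bar> * (A + B * R))" using h by simp
    show "AE x in lebesgue_on \<Omega>. norm (h x *\<^sub>R f m x) \<le> \<bar>h x\<bar> * (A + B * R)" for m
      using f_le by (intro AE_I2) (simp add: space_restrict_space mult_left_mono)
    show "AE x in lebesgue_on \<Omega>. (\<lambda>m. h x *\<^sub>R f m x) \<longlonglongrightarrow> h x *\<^sub>R g x"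
      using lim by (intro AE_I2 tendsto_scaleR tendsto_const)
  qed (use h assms(1,2) borel_measurable_lebesgue_on_of_borel in \<open>auto intro!: borel_measurable_scaleR\<close>)
qed

text \<open>Pairings over a Lebesgue measurable set are pairings over the whole space, for Borel measure, with
a Borel version of the function extended by zero.\<close>

lemma lebesgue_on_pairing_as_lborel:
  fixes h :: "'a::euclidean_space \<Rightarrow> real"
  assumes \<Omega>: "\<Omega> \<in> sets lebesgue" and h: "integrable (lebesgue_on \<Omega>) h"
  shows "\<exists>h'. integrable lborel h' \<and> (\<forall>D\<in>borel_measurable borel.
    (LINT x|lebesgue_on \<Omega>. h x * D x) = (\<integral>x. h' x * D x \<partial>lborel))"
proof -
  define k where "k x = indicator \<Omega> x * h x" for x
  have k: "integrable lebesgue k"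
    using h \<Omega> by (simp add: k_def[abs_def] integrable_restrict_space)
  then obtain h' where h' [measurable]: "h' \<in> borel_measurable lborel" and ae: "AE x in lborel. k x = h' x"
    using completion_ex_borel_measurable_real[of k lborel] by auto
  have ae': "AE x in lebesgue. k x = h' x" using ae by (rule AE_completion)
  have "integrable lebesgue h'"
    using k ae' by (subst integrable_cong_AE[symmetric, where f = k]) (auto intro: measurable_completion)
  then have "integrable lborel h'" by (simp add: integrable_completion)
  moreover have "(LINT x|lebesgue_on \<Omega>. h x * D x) = (\<integral>x. h' x * D x \<partial>lborel)"
    if [measurable]: "D \<in> borel_measurable borel" for D
  proof -
    have D: "D \<in> borel_measurable lebesgue" by (intro measurable_completion) simp
    have "(LINT x|lebesgue_on \<Omega>. h x * D x) = (LINT x|lebesgue. k x * D x)"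
      using \<Omega> by (simp add: integral_restrict_space k_def mult.assoc)
    also have "\<dots> = (LINT x|lebesgue. h' x * D x)"
    proof (rule integral_cong_AE)
      show "AE x in lebesgue. k x * D x = h' x * D x" using ae' by eventually_elim simp
    qed (use k D in \<open>auto intro!: borel_measurable_times intro: measurable_completion\<close>)
    also have "\<dots> = (\<integral>x. h' x * D x \<partial>lborel)" by (rule integral_completion) simp
    finally show ?thesis .
  qed
  ultimately show ?thesis by blast
qed

lemma weak_star_L_infinity_matrix:
  fixes D :: "nat \<Rightarrow> 'a::euclidean_space \<Rightarrow> real^'n::finite^'m::finite"
  assumes D: "\<And>m i j. (\<lambda>x. D m x $ i $ j) \<in> borel_measurable borel" "\<And>m x i j. \<bar>D m x $ i $ j\<bar> \<le> B"
    and G: "\<And>i j. (\<lambda>x. G x $ i $ j) \<in> borel_measurable borel" "\<And>x i j. \<bar>G x $ i $ j\<bar> \<le> B"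
    and lim: "\<And>i j h. integrable lborel h \<Longrightarrow>
      (\<lambda>m. \<integral>x. h x * D m x $ i $ j \<partial>lborel) \<longlonglongrightarrow> (\<integral>x. h x * G x $ i $ j \<partial>lborel)"
    and \<Omega>: "\<Omega> \<in> sets lebesgue" "bounded \<Omega>"
  shows "weak_star_L_infinity \<Omega> D G"
  unfolding weak_star_L_infinity_def
proof (intro conjI allI impI)
  define K where "K = real CARD('m) * (real CARD('n) * B)"
  have meas: "D m \<in> borel_measurable borel" "G \<in> borel_measurable borel" for m
    using D(1) G(1) by (auto intro: borel_measurable_matrix)
  have le: "norm (D m x) \<le> K + 0 * norm x" "norm (G x) \<le> K + 0 * norm x" for m x
    unfolding K_def using D(2) G(2) by (auto intro!: norm_matrix_le)
  show "L_infinity \<Omega> (D m)" for m using meas le(1) \<Omega>(2) by (intro L_infinity_of_bounded[of _ K 0]) auto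
  show "L_infinity \<Omega> G" using meas le(2) \<Omega>(2) by (intro L_infinity_of_bounded[of _ K 0]) auto
  fix h :: "'a \<Rightarrow> real" assume h: "integrable (lebesgue_on \<Omega>) h"
  have component: "(LINT x|lebesgue_on \<Omega>. h x *\<^sub>R M x) $ i $ j = (LINT x|lebesgue_on \<Omega>. h x * M x $ i $ j)"
    if M: "M \<in> borel_measurable borel" "\<And>x. norm (M x) \<le> K" for M :: "'a \<Rightarrow> real^'n^'m" and i j
  proof -
    have "integrable (lebesgue_on \<Omega>) (\<lambda>x. h x *\<^sub>R M x)"
    proof (rule Bochner_Integration.integrable_bound)
      show "integrable (lebesgue_on \<Omega>) (\<lambda>x. \<bar>h x\<bar> * K)" using h by simp
      show "AE x in lebesgue_on \<Omega>. norm (h x *\<^sub>R M x) \<le> norm (\<bar>h x\<bar> * K)"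
        using M(2) by (intro AE_I2) (simp add: abs_mult mult_left_mono order_trans[OF _ abs_ge_self])
    qed (use h borel_measurable_lebesgue_on_of_borel[OF M(1)] in \<open>auto intro: borel_measurable_scaleR\<close>)
    from integral_bounded_linear[OF bounded_linear_compose[OF bounded_linear_vec_nth bounded_linear_vec_nth] this, of i j]
    show ?thesis by simp
  qed
  obtain h' where h': "integrable lborel h'" "\<And>D. D \<in> borel_measurable borel \<Longrightarrow>
    (LINT x|lebesgue_on \<Omega>. h x * D x) = (\<integral>x. h' x * D x \<partial>lborel)"
    using lebesgue_on_pairing_as_lborel[OF \<Omega>(1) h] by blast
  show "(\<lambda>m. LINT x|lebesgue_on \<Omega>. h x *\<^sub>R D m x) \<longlonglongrightarrow> (LINT x|lebesgue_on \<Omega>. h x *\<^sub>R G x)"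
  proof (intro vec_tendstoI)
    fix i j
    show "(\<lambda>m. (LINT x|lebesgue_on \<Omega>. h x *\<^sub>R D m x) $ i $ j) \<longlonglongrightarrow> (LINT x|lebesgue_on \<Omega>. h x *\<^sub>R G x) $ i $ j"
      using lim[OF h'(1), of i j] le by (simp add: component meas h'(2) D(1) G(1))
  qed
qed

text \<open>The entries of the Jacobians are taken as limits of difference quotients, which are Borel functions.
The truncation to \<open>[-1, 1]\<close> affects only the null set where a fold composition is not differentiable,
as fold compositions are nonexpansive.\<close>

lemma fold_compositions_weak_star:
  fixes F :: "nat \<Rightarrow> real^'n::finite \<Rightarrow> real^'n"
  assumes F: "\<And>m. F m \<in> fold_compositions" and lim: "\<And>x. (\<lambda>m. F m x) \<longlonglongrightarrow> p x"
  shows "weak_star_W1_infinity_loc F p"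
proof -
  have F_meas [measurable]: "F m \<in> borel_measurable borel" for m
    using fold_compositions_continuous[OF F] by (rule borel_measurable_continuous_onI)
  have p_meas [measurable]: "p \<in> borel_measurable borel"
    by (rule borel_measurable_LIMSEQ_metric[of F]) (use lim F_meas in auto)
  have "convergent (\<lambda>m. F m 0)" using lim[of 0] by (auto simp: convergent_def)
  then obtain A where A: "\<And>m. norm (F m 0) \<le> A"
    using convergent_imp_bounded[of "\<lambda>m. F m 0"] unfolding convergent_def bounded_iff by blast
  have F_le: "norm (F m x) \<le> A + 1 * norm x" for m x
    using A[of m] fold_compositions_nonexpansive[OF F, of m x 0] norm_triangle_sub[of "F m x" "F m 0"]
    by (simp add: dist_norm)
  have p_le: "norm (p x) \<le> A + 1 * norm x" for x
    by (rule LIMSEQ_le_const2[OF tendsto_norm[OF lim]]) (use F_le in auto)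
  define D where "D m i j x = max (-1) (min 1 (lim (\<lambda>n. diff_quotient (axis j 1) (\<lambda>x. F m x $ i) n x)))" for m i j x
  have D_meas: "D m i j \<in> borel_measurable borel" for m i j
  proof -
    have "diff_quotient (axis j 1) (\<lambda>x. F m x $ i) n \<in> borel_measurable borel" for n
      by (rule borel_measurable_diff_quotient) measurable
    then show ?thesis unfolding D_def[abs_def] by measurable
  qed
  have D_le: "\<bar>D m i j x\<bar> \<le> 1" for m i j x by (auto simp: D_def)
  have F_lip: "\<bar>F m x $ i - F m y $ i\<bar> \<le> dist x y" for m x y i
    using component_le_norm_cart[of "F m x - F m y" i] fold_compositions_nonexpansive[OF F, of m x y]
    by (simp add: dist_norm)
  have F_dir: "\<bar>F m (x + s *\<^sub>R axis j 1) $ i - F m x $ i\<bar> \<le> 1 * \<bar>s\<bar>" for m x s i j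
    using F_lip[of m "x + s *\<^sub>R axis j 1" i x] by (simp add: dist_norm)
  have D_lim: "AE x in lborel. (\<lambda>n. diff_quotient (axis j 1) (\<lambda>x. F m x $ i) n x) \<longlonglongrightarrow> D m i j x" for m i j
  proof -
    have "AE x in lborel. \<exists>R::real^'n^'n. orthogonal_matrix R \<and> (F m has_derivative (\<lambda>v. R *v v)) (at x)"
      using fold_compositions_derivative_ae[OF F] by (simp add: AE_completion_iff)
    then show ?thesis
    proof eventually_elim
      case (elim x)
      then obtain R :: "real^'n^'n" where R: "(F m has_derivative (\<lambda>v. R *v v)) (at x)" by blast
      have "((\<lambda>x. F m x $ i) has_derivative (\<lambda>v. (R *v v) $ i)) (at x)"
        using bounded_linear.has_derivative[OF bounded_linear_vec_nth R] .
      from diff_quotient_LIMSEQ(1)[OF has_derivative_imp_directional[OF this, of "axis j 1"]]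
      obtain c where c: "(\<lambda>n. diff_quotient (axis j 1) (\<lambda>x. F m x $ i) n x) \<longlonglongrightarrow> c" by blast
      have "\<bar>c\<bar> \<le> 1"
        by (rule LIMSEQ_le_const2[OF tendsto_rabs[OF c]])
           (use abs_diff_quotient_le(1)[of "\<lambda>x. F m x $ i" "axis j 1" 1, OF F_dir] in auto)
      then have "D m i j x = c" using limI[OF c] by (simp add: D_def abs_le_iff)
      then show ?case using c by simp
    qed
  qed
  have axis: "axis j 1 \<in> (Basis :: (real^'n) set)" for j by (simp add: axis_in_Basis_iff)
  have "\<exists>G\<in>borel_measurable borel. (\<forall>x. \<bar>G x\<bar> \<le> 1) \<and>
    (\<forall>h. integrable lborel h \<longrightarrow> (\<lambda>m. \<integral>x. h x * D m i j x \<partial>lborel) \<longlonglongrightarrow> (\<integral>x. h x * G x \<partial>lborel)) \<and>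
    (\<forall>g g'. directional_test (axis j 1) g g' \<longrightarrow> (\<integral>x. p x $ i * g' x \<partial>lborel) = - (\<integral>x. G x * g x \<partial>lborel))" for i j
    by (rule weak_derivative_limit[OF axis F_lip D_meas D_le D_lim tendsto_vec_nth[OF lim]])
  then have "\<forall>i j. \<exists>G. G \<in> borel_measurable borel \<and> (\<forall>x. \<bar>G x\<bar> \<le> 1) \<and>
    (\<forall>h. integrable lborel h \<longrightarrow> (\<lambda>m. \<integral>x. h x * D m i j x \<partial>lborel) \<longlonglongrightarrow> (\<integral>x. h x * G x \<partial>lborel)) \<and>
    (\<forall>g g'. directional_test (axis j 1) g g' \<longrightarrow> (\<integral>x. p x $ i * g' x \<partial>lborel) = - (\<integral>x. G x * g x \<partial>lborel))"
    by blast
  then obtain G where "\<forall>i j. G i j \<in> borel_measurable borel \<and> (\<forall>x. \<bar>G i j x\<bar> \<le> 1) \<and>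
    (\<forall>h. integrable lborel h \<longrightarrow> (\<lambda>m. \<integral>x. h x * D m i j x \<partial>lborel) \<longlonglongrightarrow> (\<integral>x. h x * G i j x \<partial>lborel)) \<and>
    (\<forall>g g'. directional_test (axis j 1) g g' \<longrightarrow> (\<integral>x. p x $ i * g' x \<partial>lborel) = - (\<integral>x. G i j x * g x \<partial>lborel))"
    unfolding choice_iff by blast
  then have G_meas: "\<And>i j. G i j \<in> borel_measurable borel" and G_le: "\<And>i j x. \<bar>G i j x\<bar> \<le> 1"
    and G_lim: "\<And>i j h. integrable lborel h \<Longrightarrow>
      (\<lambda>m. \<integral>x. h x * D m i j x \<partial>lborel) \<longlonglongrightarrow> (\<integral>x. h x * G i j x \<partial>lborel)"
    and G_parts: "\<And>i j g g'. directional_test (axis j 1) g g' \<Longrightarrow>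
      (\<integral>x. p x $ i * g' x \<partial>lborel) = - (\<integral>x. G i j x * g x \<partial>lborel)"
    by blast+
  have jacobian: "is_weak_jacobian f (\<lambda>x. \<chi> i j. H i j x)"
    if f [measurable]: "f \<in> borel_measurable borel" and f_le: "\<And>x. norm (f x) \<le> A + 1 * norm x"
      and H: "\<And>i j. H i j \<in> borel_measurable borel" "\<And>i j x. \<bar>H i j x\<bar> \<le> 1"
      and parts: "\<And>i j g g'. directional_test (axis j 1) g g' \<Longrightarrow>
        (\<integral>x. f x $ i * g' x \<partial>lborel) = - (\<integral>x. H i j x * g x \<partial>lborel)"
    for f :: "real^'n \<Rightarrow> real^'n" and H :: "'n \<Rightarrow> 'n \<Rightarrow> real^'n \<Rightarrow> real"
    unfolding is_weak_jacobian_def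
  proof (intro conjI allI impI)
    show "locally_integrable f" using f_le by (intro locally_integrable_of_bounded[OF f, of A 1]) auto
    show "locally_integrable (\<lambda>x. \<chi> i j. H i j x)"
    proof (rule locally_integrable_of_bounded)
      show "(\<lambda>x. \<chi> i j. H i j x) \<in> borel_measurable borel"
        by (rule borel_measurable_matrix) (simp add: H)
      show "norm (\<chi> i j. H i j x) \<le> real CARD('n) * (real CARD('n) * 1) + 0 * norm x" for x
        using norm_matrix_le[of "\<chi> i j. H i j x" 1] H(2) by simp
    qed simp
    fix \<phi> :: "real^'n \<Rightarrow> real" and i j assume "test_function \<phi>"
    then have test: "directional_test (axis j 1) \<phi> (partial_derivative j \<phi>)" by (rule test_function_directional)
    then have [measurable]: "\<phi> \<in> borel_measurable borel" "partial_derivative j \<phi> \<in> borel_measurable borel"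
      by (auto simp: directional_test_def)
    note [measurable] = H(1)
    show "(LINT x|lebesgue. f x $ i * partial_derivative j \<phi> x)
        = - (LINT x|lebesgue. (\<chi> i j. H i j x) $ i $ j * \<phi> x)"
      using parts[OF test, of i] by (simp add: integral_completion)
  qed
  show ?thesis
    unfolding weak_star_W1_infinity_loc_def
  proof (intro exI[of _ "\<lambda>m x. \<chi> i j. D m i j x"] exI[of _ "\<lambda>x. \<chi> i j. G i j x"] conjI allI ballI impI)
    show "is_weak_jacobian (F m) (\<lambda>x. \<chi> i j. D m i j x)" for m
    proof (rule jacobian[OF F_meas F_le D_meas D_le])
      show "(\<integral>x. F m x $ i * g' x \<partial>lborel) = - (\<integral>x. D m i j x * g x \<partial>lborel)"
        if "directional_test (axis j 1) g g'" for i j g g'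
        by (rule integration_by_parts[OF _ F_dir D_meas D_lim that])
           (intro continuous_intros fold_compositions_continuous[OF F])
    qed
    show "is_weak_jacobian p (\<lambda>x. \<chi> i j. G i j x)"
      by (rule jacobian[OF p_meas p_le G_meas G_le G_parts])
    fix \<Omega> :: "(real^'n) set" assume \<Omega>: "\<Omega> \<in> sets lebesgue" "bounded \<Omega>"
    show "weak_star_L_infinity \<Omega> F p"
      by (rule weak_star_L_infinity_of_pointwise[OF F_meas p_meas F_le p_le _ lim \<Omega>(2)]) simp
    show "weak_star_L_infinity \<Omega> (\<lambda>m x. \<chi> i j. D m i j x) (\<lambda>x. \<chi> i j. G i j x)"
      by (rule weak_star_L_infinity_matrix[OF _ _ _ _ _ \<Omega>, of _ 1])
         (simp_all add: D_meas D_le G_meas G_le G_lim)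
  qed
qed

section \<open>Approximating the projection onto a convex body\<close>

theorem theorem2p1:
  fixes C :: "(real^'n::finite) set"
  assumes "compact C" and "convex C" and "interior C \<noteq> {}" and "0 \<in> interior C"
  shows "\<exists>F :: nat \<Rightarrow> real^'n \<Rightarrow> real^'n.
    (\<forall>m\<ge>1. locally_lipschitz (F m)) \<and>
    (\<forall>m\<ge>1. piecewise_reflections (F m) \<and>
       (AE u in lebesgue. \<exists>R::real^'n^'n. orthogonal_matrix R \<and>
          (F m has_derivative (\<lambda>v. R *v v)) (at u))) \<and>
    (\<forall>m\<ge>1. (\<forall>u\<in>C. F m u = u) \<and> (\<forall>E. E \<subseteq> C \<longrightarrow> F m ` E = E) \<and>
       F m ` ((\<lambda>u. real m *\<^sub>R u) ` C) \<subseteq> (\<lambda>u. (1 + 1 / real m) *\<^sub>R u) ` C) \<and>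
    (\<forall>K. compact K \<longrightarrow> uniform_limit K F (closest_point C) sequentially) \<and>
    weak_star_W1_infinity_loc (\<lambda>m. F (Suc m)) (closest_point C)"
proof -
  have C0: "0 \<in> C" using assms(4) interior_subset by blast
  interpret convex_body C
    using assms C0 by unfold_locales auto
  obtain r where r: "0 < r" "ball 0 r \<subseteq> C"
    using assms(4) mem_interior by blast
  obtain \<rho> where \<rho>: "\<And>x. x \<in> C \<Longrightarrow> norm x \<le> \<rho>"
    using compact_imp_bounded[OF compact] unfolding bounded_iff by blast
  have \<rho>0: "0 \<le> \<rho>" using \<rho>[OF C0] by simp
  \<comment> \<open>The factor r / 3 makes the 2 \<tau>-neighbourhood of C fit into the dilate of C by 1 + 1 / m; see the proof of dilate.\<close>
  define \<tau> where "\<tau> m = min 1 (r / 3) / real (Suc m)" for m :: nat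
  have \<tau>: "0 < \<tau> m" "\<tau> m \<le> 1" "m * (2 * \<tau> m) < r" for m
  proof -
    have a: "0 < min 1 (r / 3)" "min 1 (r / 3) \<le> 1" "min 1 (r / 3) \<le> r / 3" using r by auto
    show "0 < \<tau> m" using a by (simp add: \<tau>_def)
    show "\<tau> m \<le> 1" using a(2) by (simp add: \<tau>_def divide_le_eq)
    have "real m * min 1 (r / 3) \<le> real (Suc m) * min 1 (r / 3)"
      using a(1) by (intro mult_right_mono) auto
    then have "real m * \<tau> m \<le> min 1 (r / 3)"
      unfolding \<tau>_def times_divide_eq_right by (subst divide_le_eq) (simp add: mult.commute)
    then show "m * (2 * \<tau> m) < r" using a(3) r(1) by linarith
  qed
  have "\<exists>F\<in>fold_compositions. (\<forall>x\<in>C. F x = x) \<and>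
      (\<forall>x. d x \<le> real m * \<rho> + real m \<longrightarrow> d (F x) \<le> 2 * \<tau> m \<and> dist x (F x) \<le> (1 + \<tau> m) * d x)" for m
    using almost_projecting_fold[OF \<tau>(1,2)] .
  then obtain F where F: "\<And>m. F m \<in> fold_compositions" and F_id: "\<And>m x. x \<in> C \<Longrightarrow> F m x = x"
    and F_close: "\<And>m x. d x \<le> real m * \<rho> + real m \<Longrightarrow> d (F m x) \<le> 2 * \<tau> m \<and> dist x (F m x) \<le> (1 + \<tau> m) * d x"
    by metis
  have d_norm: "d x \<le> norm x" for x using d_le[OF C0, of x] by simp
  have lipschitz: "locally_lipschitz (F m)" for m
    unfolding locally_lipschitz_def using fold_compositions_lipschitz[OF F[of m]] zero_less_one by blast
  have dilate: "F m ` ((\<lambda>u. real m *\<^sub>R u) ` C) \<subseteq> (\<lambda>u. (1 + 1 / real m) *\<^sub>R u) ` C" if m: "m \<ge> 1" for m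
  proof (intro subsetI, elim imageE, clarify)
    fix u assume u: "u \<in> C"
    have "norm (real m *\<^sub>R u) \<le> real m * \<rho>" using \<rho>[OF u] by (simp add: mult_left_mono)
    then have "d (real m *\<^sub>R u) \<le> real m * \<rho> + real m" using d_norm[of "real m *\<^sub>R u"] by linarith
    then have near: "d (F m (real m *\<^sub>R u)) \<le> 2 * \<tau> m" using F_close by blast
    define z where "z = F m (real m *\<^sub>R u)"
    \<comment> \<open>The image point z is P z + v / m with both P z and v in C, hence a multiple of a convex combination.\<close>
    define v where "v = real m *\<^sub>R (z - P z)"
    have "norm v = real m * d z" by (simp add: v_def d_def dist_norm)
    also have "\<dots> \<le> real m * (2 * \<tau> m)" using near by (intro mult_left_mono) (auto simp: z_def)
    finally have "v \<in> C" using r(2) \<tau>(3)[of m] by (auto simp: subset_iff)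
    define s where "s = 1 + 1 / real m"
    have s: "0 < s" "1 / s + (1 / real m) / s = 1" using m by (auto simp: s_def field_simps add_pos_pos)
    have "(1 / s) *\<^sub>R P z + ((1 / real m) / s) *\<^sub>R v \<in> C"
      using s by (intro convexD[OF convex P_in \<open>v \<in> C\<close>]) auto
    moreover have "z = s *\<^sub>R ((1 / s) *\<^sub>R P z + ((1 / real m) / s) *\<^sub>R v)"
      using s(1) m by (simp add: scaleR_add_right v_def)
    ultimately show "F m (real m *\<^sub>R u) \<in> (\<lambda>u. (1 + 1 / real m) *\<^sub>R u) ` C"
      unfolding z_def[symmetric] s_def[symmetric] by blast
  qed
  have uniform: "uniform_limit K F P sequentially" if K: "compact K" for K
  proof (rule uniform_limitI)
    fix \<epsilon> :: real assume \<epsilon>: "0 < \<epsilon>"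
    obtain R where R: "\<And>x. x \<in> K \<Longrightarrow> norm x \<le> R"
      using compact_imp_bounded[OF K] unfolding bounded_iff by blast
    have "\<tau> \<longlonglongrightarrow> min 1 (r / 3) * 0"
      unfolding \<tau>_def[abs_def] divide_inverse by (intro tendsto_mult_left LIMSEQ_inverse_real_of_nat)
    then have "\<tau> \<longlonglongrightarrow> 0" by simp
    then have "(\<lambda>m. 2 * \<tau> m + sqrt (\<tau> m * ((R + 2) * (3 * R + 2)))) \<longlonglongrightarrow> 2 * 0 + sqrt (0 * ((R + 2) * (3 * R + 2)))"
      by (intro tendsto_intros)
    then have "\<forall>\<^sub>F m in sequentially. 2 * \<tau> m + sqrt (\<tau> m * ((R + 2) * (3 * R + 2))) < \<epsilon>"
      using \<epsilon> by (intro order_tendstoD(2)) auto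
    moreover obtain M :: nat where M: "R \<le> real M" using real_arch_simple by blast
    have "\<forall>\<^sub>F m in sequentially. M \<le> m" by (rule eventually_ge_at_top)
    ultimately show "\<forall>\<^sub>F m in sequentially. \<forall>x\<in>K. dist (F m x) (P x) < \<epsilon>"
    proof eventually_elim
      case (elim m)
      show ?case
      proof
        fix x assume "x \<in> K"
        have d: "d x \<le> R" using d_norm[of x] R[OF \<open>x \<in> K\<close>] by linarith
        have "0 \<le> real m * \<rho>" using \<rho>0 by simp
        then have "d x \<le> real m * \<rho> + real m" using d M elim(2) by linarith
        then show "dist (F m x) (P x) < \<epsilon>"
          using near_projection[of "\<tau> m" "F m x" x R] F_close[of x m] \<tau>[of m] d elim(1) by linarith
      qed
    qed
  qed
  have weak: "weak_star_W1_infinity_loc (\<lambda>m. F (Suc m)) P"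
  proof (rule fold_compositions_weak_star)
    show "(\<lambda>m. F (Suc m) x) \<longlonglongrightarrow> P x" for x
      by (rule LIMSEQ_Suc, rule tendsto_uniform_limitI[OF uniform[of "{x}"]]) auto
  qed (rule F)
  show ?thesis
    using lipschitz fold_compositions_piecewise_reflections[OF F] fold_compositions_derivative_ae[OF F]
      F_id dilate uniform weak
    by (intro exI[of _ F] conjI allI impI ballI) (auto simp: image_iff subset_iff)
qed

end
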